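(* Let $R=\Bbbk[z][x,y;\sigma,a]$ be a classical generalized Weyl algebra with $\sigma(z)=z-1$, where $a\in\Bbbk[z]$ is monic and has $0$ as a root. Let $G$ be a finite nontrivial cyclic subgroup of the group $\operatorname{Aut}_{\mathrm{fl}}(R)$ of filtered automorphisms of $R$. Then the Auslander map $$\gamma_{R,G}: R\# G\longrightarrow \operatorname{End}_{R^G}(R),\qquad r\# g\longmapsto \bigl(b\mapsto r\,g(b)\bigr)$$ is an isomorphism.
   Context: $\Bbbk$ is an algebraically closed field of characteristic zero; all algebras are $\Bbbk$-algebras. Classical GWA: $R=\Bbbk[z][x,y;\sigma,a]$, with $\sigma(z)=z-1$, is the ring obtained by adjoining to $\Bbbk[z]$ the variables $x,y$ subject to $xy=\sigma(a)$, $yx=a$, $xd=\sigma(d)x$, $yd=\sigma^{-1}(d)y$ for all $d\in\Bbbk[z]$. Standard filtration: with $n=\deg_z(a)$, it is the filtration on $R$ defined by $\deg x=\deg y=n$, $\deg z=2$. A filtered automorphism is a $\Bbbk$-algebra automorphism $\phi$ with $\deg(\phi(r))=\deg(r)$ for all $r\in R$; $\operatorname{Aut}_{\mathrm{fl}}(R)$ is the group of these. Skew group algebra: $R\# G$ is the vector space $R\otimes\Bbbk G$ with multiplication $(a\# g)(b\# h)=a\,g(b)\# gh$. $R^G$ is the fixed ring, and $\operatorname{End}_{R^G}(R)$ is the ring of endomorphisms of $R$ as a right $R^G$-module. *)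

theory Defs
  imports
    "HOL-Algebra.QuotRing"
    "HOL-Algebra.Module"
    "HOL-Algebra.Bij"
    "HOL-Algebra.Elementary_Groups"
    "HOL-Library.Poly_Mapping"
    "HOL-Computational_Algebra.Polynomial"
begin

text \<open>
  The scalars are the elements of a type \<open>'k\<close> of class \<open>field\<close>. A \<open>'k\<close>-algebra is presented as a
  record of type \<open>('k, 'r) module\<close>, i.e. a ring record together with a scalar multiplication.
\<close>

definition alg_iso :: "('k, 'r) module \<Rightarrow> ('k, 's) module \<Rightarrow> ('r \<Rightarrow> 's) set" where
  "alg_iso A B =
     {\<phi> \<in> ring_iso A B. \<forall>c. \<forall>r \<in> carrier A. \<phi> (c \<odot>\<^bsub>A\<^esub> r) = c \<odot>\<^bsub>B\<^esub> \<phi> r}"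


section \<open>The free algebra on x, y, z\<close>

datatype gen = GX | GY | GZ

text \<open>Words form the free monoid, written additively (but not commutative), so that the
  convolution product of \<open>word \<Rightarrow>\<^sub>0 'k\<close> is the product of the free associative algebra.\<close>

datatype word = Word (letters: "gen list")

instantiation word :: monoid_add
begin

definition zero_word :: word where "0 = Word []"

definition plus_word :: "word \<Rightarrow> word \<Rightarrow> word" where
  "u + v = Word (letters u @ letters v)"

instance
  by standard (simp_all add: zero_word_def plus_word_def)

end

type_synonym 'k free_alg = "word \<Rightarrow>\<^sub>0 'k"

definition free_alg :: "('k::field) free_alg ring" where
  "free_alg = \<lparr>carrier = UNIV, monoid.mult = (*), one = 1, zero = 0, add = (+)\<rparr>"

definition var :: "gen \<Rightarrow> ('k::field) free_alg" where
  "var g = Poly_Mapping.single (Word [g]) 1"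

definition const :: "'k \<Rightarrow> ('k::field) free_alg" where
  "const c = Poly_Mapping.single 0 c"

text \<open>The copy of \<open>'k[z]\<close> inside the free algebra.\<close>

definition in_z :: "('k::field) poly \<Rightarrow> 'k free_alg" where
  "in_z d = (\<Sum>i\<le>degree d. const (Polynomial.coeff d i) * var GZ ^ i)"


section \<open>Generalized Weyl algebras over the polynomial ring\<close>

definition gwa_rels :: "('k::field poly \<Rightarrow> 'k poly) \<Rightarrow> 'k poly \<Rightarrow> 'k free_alg set" where
  "gwa_rels \<sigma> a =
     {var GX * var GY - in_z (\<sigma> a), var GY * var GX - in_z a}
     \<union> (\<Union>d. {var GX * in_z d - in_z (\<sigma> d) * var GX,
              var GY * in_z d - in_z (inv_into UNIV \<sigma> d) * var GY})"

definition gwa_ideal :: "('k::field poly \<Rightarrow> 'k poly) \<Rightarrow> 'k poly \<Rightarrow> 'k free_alg set" where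
  "gwa_ideal \<sigma> a = Idl\<^bsub>free_alg\<^esub> (gwa_rels \<sigma> a)"

definition gwa ::
  "('k::field poly \<Rightarrow> 'k poly) \<Rightarrow> 'k poly \<Rightarrow> ('k, 'k free_alg set) module" where
  "gwa \<sigma> a = (let I = gwa_ideal \<sigma> a; Q = free_alg Quot I in
     \<lparr>carrier = carrier Q, monoid.mult = monoid.mult Q, one = one Q, zero = zero Q, add = add Q,
      module.smult = (\<lambda>c r. (I +>\<^bsub>free_alg\<^esub> const c) \<otimes>\<^bsub>Q\<^esub> r)\<rparr>)"

text \<open>The automorphism \<open>\<sigma>\<close> of \<open>'k[z]\<close> with \<open>\<sigma>(z) = z - 1\<close>.\<close>

definition shift :: "('k::field) poly \<Rightarrow> 'k poly" where
  "shift d = pcompose d [:-1, 1:]"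

lemma inv_shift: "inv_into UNIV shift d = pcompose d [:1, 1:]"
proof -
  have left: "pcompose (shift p) [:1, 1:] = p" for p :: "'a poly"
    by (simp add: shift_def pcompose_assoc [symmetric] pcompose_pCons)
  have right: "shift (pcompose p [:1, 1:]) = p" for p :: "'a poly"
    by (simp add: shift_def pcompose_assoc [symmetric] pcompose_pCons)
  have "inj (shift :: 'a poly \<Rightarrow> 'a poly)"
    using left by (metis injI)
  then show ?thesis
    using right by (rule inv_f_eq)
qed

definition classical_gwa :: "('k::field) poly \<Rightarrow> ('k, 'k free_alg set) module" where
  "classical_gwa a = gwa shift a"


section \<open>The standard filtration and filtered automorphisms\<close>

fun gen_deg :: "nat \<Rightarrow> gen \<Rightarrow> nat" where
  "gen_deg n GX = n"
| "gen_deg n GY = n"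
| "gen_deg n GZ = 2"

definition word_deg :: "nat \<Rightarrow> word \<Rightarrow> nat" where
  "word_deg n w = sum_list (map (gen_deg n) (letters w))"

text \<open>The \<open>m\<close>-th piece is the span of the images of all words of weight at most \<open>m\<close>.\<close>

definition std_filtration :: "('k::field) poly \<Rightarrow> nat \<Rightarrow> 'k free_alg set set" where
  "std_filtration a m =
     {gwa_ideal shift a +>\<^bsub>free_alg\<^esub> p | p. \<forall>w \<in> Poly_Mapping.keys p. word_deg (degree a) w \<le> m}"

text \<open>The degree of 0 is 0 here; as automorphisms fix 0, the convention is irrelevant below.\<close>

definition std_deg :: "('k::field) poly \<Rightarrow> 'k free_alg set \<Rightarrow> nat" where
  "std_deg a r = (LEAST m. r \<in> std_filtration a m)"

text \<open>As in \<^const>\<open>BijGroup\<close>, automorphisms are extensional functions on the carrier.\<close>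

definition filtered_auts :: "('k::field) poly \<Rightarrow> ('k free_alg set \<Rightarrow> 'k free_alg set) set" where
  "filtered_auts a =
     {\<phi> \<in> extensional (carrier (classical_gwa a)) \<inter> alg_iso (classical_gwa a) (classical_gwa a).
        \<forall>r \<in> carrier (classical_gwa a). std_deg a (\<phi> r) = std_deg a r}"

definition Aut_fl :: "('k::field) poly \<Rightarrow> ('k free_alg set \<Rightarrow> 'k free_alg set) monoid" where
  "Aut_fl a = (BijGroup (carrier (classical_gwa a))) \<lparr>carrier := filtered_auts a\<rparr>"


section \<open>The Auslander map\<close>

text \<open>Below, \<open>G\<close> is a finite group of (extensional) automorphisms of the algebra \<open>R\<close> under
  composition. An element \<open>f\<close> of \<open>R \<otimes> 'k[G]\<close> is a function \<open>G \<rightarrow> R\<close>, standing for the sum of all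
  \<open>f g # g\<close>; the product is the bilinear extension of \<open>(r # g)(s # h) = r g(s) # gh\<close>.\<close>

definition skew_group_algebra ::
  "('k, 'r) module \<Rightarrow> ('r \<Rightarrow> 'r) set \<Rightarrow> ('k, ('r \<Rightarrow> 'r) \<Rightarrow> 'r) module" where
  "skew_group_algebra R G =
     \<lparr>carrier = G \<rightarrow>\<^sub>E carrier R,
      monoid.mult = (\<lambda>f f'. \<lambda>k\<in>G.
        finsum R (\<lambda>(g, h). f g \<otimes>\<^bsub>R\<^esub> g (f' h)) {(g, h) \<in> G \<times> G. compose (carrier R) g h = k}),
      one = (\<lambda>g\<in>G. if g = (\<lambda>r\<in>carrier R. r) then \<one>\<^bsub>R\<^esub> else \<zero>\<^bsub>R\<^esub>),
      zero = (\<lambda>g\<in>G. \<zero>\<^bsub>R\<^esub>),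
      add = (\<lambda>f f'. \<lambda>g\<in>G. f g \<oplus>\<^bsub>R\<^esub> f' g),
      module.smult = (\<lambda>c f. \<lambda>g\<in>G. c \<odot>\<^bsub>R\<^esub> f g)\<rparr>"

definition fixed_ring :: "('k, 'r) module \<Rightarrow> ('r \<Rightarrow> 'r) set \<Rightarrow> 'r set" where
  "fixed_ring R G = {r \<in> carrier R. \<forall>g\<in>G. g r = r}"

text \<open>The algebra of endomorphisms of \<open>R\<close> as a right module over the subring \<open>S\<close>.\<close>

definition right_End :: "'r set \<Rightarrow> ('k, 'r) module \<Rightarrow> ('k, 'r \<Rightarrow> 'r) module" where
  "right_End S R =
     \<lparr>carrier = {f \<in> carrier R \<rightarrow>\<^sub>E carrier R.
        (\<forall>r\<in>carrier R. \<forall>r'\<in>carrier R. f (r \<oplus>\<^bsub>R\<^esub> r') = f r \<oplus>\<^bsub>R\<^esub> f r') \<and>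
        (\<forall>r\<in>carrier R. \<forall>s\<in>S. f (r \<otimes>\<^bsub>R\<^esub> s) = f r \<otimes>\<^bsub>R\<^esub> s)},
      monoid.mult = compose (carrier R),
      one = (\<lambda>r\<in>carrier R. r),
      zero = (\<lambda>r\<in>carrier R. \<zero>\<^bsub>R\<^esub>),
      add = (\<lambda>f f'. \<lambda>r\<in>carrier R. f r \<oplus>\<^bsub>R\<^esub> f' r),
      module.smult = (\<lambda>c f. \<lambda>r\<in>carrier R. c \<odot>\<^bsub>R\<^esub> f r)\<rparr>"

text \<open>The linear extension of \<open>r # g \<mapsto> (b \<mapsto> r g(b))\<close>.\<close>

definition auslander_map ::
  "('k, 'r) module \<Rightarrow> ('r \<Rightarrow> 'r) set \<Rightarrow> (('r \<Rightarrow> 'r) \<Rightarrow> 'r) \<Rightarrow> 'r \<Rightarrow> 'r" where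
  "auslander_map R G f = (\<lambda>b\<in>carrier R. \<Oplus>\<^bsub>R\<^esub>g\<in>G. f g \<otimes>\<^bsub>R\<^esub> g b)"

end

theory Submission
  imports Defs
begin

text \<open>
  The algebra \<open>R\<close> embeds into the skew Laurent ring \<open>k[z][x, 1/x]\<close>, in which \<open>x p = \<sigma>(p) x\<close>, by
  \<open>y = a x\<^sup>-\<^sup>1\<close>; here \<open>R\<close> becomes the set of all \<open>\<Sum> p\<^sub>k x\<^sup>k\<close> such that, for \<open>k < 0\<close>, the coefficient
  \<open>p\<^sub>k\<close> is divisible by that of \<open>y\<^sup>-\<^sup>k\<close>. If \<open>x\<close> gets degree \<open>n = deg a\<close> and \<open>z\<close> gets degree \<open>2\<close>, then
  \<open>y\<close> has degree \<open>2 n - n = n\<close>, so the degree of the Laurent ring restricts to the standard filtration.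
  This degree is additive on products, and commutators have smaller degree than products: the
  associated graded ring is a commutative domain.

  Consequently no nontrivial element \<open>g\<close> of \<open>G\<close> is conjugation by an element of the division ring of
  fractions: such a conjugation acts trivially on the associated graded ring, so \<open>g(b) - b\<close> has smaller
  degree than \<open>b\<close>, and an automorphism of finite order with this property is the identity in
  characteristic zero (\<open>filtered_finite_order_outer\<close>).

  Outerness implies that every nonzero ideal of \<open>R # G\<close> meets \<open>R\<close> nontrivially
  (\<open>skew_ideal_meets_B\<close>): in an element of minimal support, two nonzero coefficients would express
  one group element as a conjugation. This is used twice. The kernel of the Auslander map meets \<open>R\<close>
  trivially because \<open>c # 1\<close> sends \<open>1\<close> to \<open>c\<close>, so the map is injective. The ideal generated by \<open>\<Sum> 1 # g\<close> meets
  \<open>R\<close> in a nonzero ideal \<open>J\<close>. As the map \<open>u (\<Sum> g) v\<close> sends \<open>b\<close> to \<open>u tr(v b)\<close> with \<open>tr(v b)\<close> fixed by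
  \<open>G\<close>, an endomorphism \<open>f\<close> over the fixed ring composed with multiplication by \<open>d \<in> J\<close> lies in the
  image: \<open>f (d b) = \<Sum> r\<^sub>g(d) g(b)\<close>.

  By uniqueness of the coefficients, \<open>d \<mapsto> g\<^sup>-\<^sup>1(r\<^sub>g(d))\<close> is a homomorphism of right \<open>R\<close>-modules from
  \<open>J\<close> to \<open>R\<close>. Every such homomorphism is left multiplication by an element of \<open>R\<close>
  (\<open>hom_from_ideal_extends\<close>), because \<open>J\<close> contains a power of \<open>x\<close> and the same power of \<open>y\<close>: the
  former, being invertible in the Laurent ring, determines the multiplier, and the latter forces it
  into \<open>R\<close>. Hence \<open>f\<close> agrees on \<open>J\<close> with an element of the image, and then everywhere, as \<open>J\<close>
  contains a nonzero fixed element, by which one can cancel (\<open>aus_surjective\<close>).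
\<close>

section \<open>Shifts of polynomials\<close>

text \<open>
  The power \<open>\<sigma>\<^sup>k\<close>. Integer exponents allow the rule \<open>x\<^sup>k p = \<sigma>\<^sup>k(p) x\<^sup>k\<close> for powers of either sign.
\<close>

definition zshift :: "int \<Rightarrow> 'k::field_char_0 poly \<Rightarrow> 'k poly" where
  "zshift k p = pcompose p [:- of_int k, 1:]"

lemma zshift_add: "zshift k (p + q) = zshift k p + zshift k q"
  and zshift_mult: "zshift k (p * q) = zshift k p * zshift k q"
  and zshift_0 [simp]: "zshift k 0 = 0"
  and zshift_1 [simp]: "zshift k 1 = 1"
  and zshift_const [simp]: "zshift k [:c:] = [:c:]"
  and zshift_sum: "zshift k (sum f A) = (\<Sum>i\<in>A. zshift k (f i))"
  by (simp_all add: zshift_def pcompose_add pcompose_mult pcompose_sum pcompose_1)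

lemma zshift_zshift [simp]: "zshift k (zshift l p) = zshift (k + l) p"
  by (simp add: zshift_def pcompose_assoc [symmetric] pcompose_pCons algebra_simps)

lemma zshift_zero [simp]: "zshift 0 p = p"
  by (simp add: zshift_def)

lemma zshift_one_eq_shift: "zshift 1 = shift"
  by (simp add: fun_eq_iff zshift_def shift_def)

lemma zshift_minus_one_eq: "zshift (- 1) = inv_into UNIV shift"
  by (simp add: fun_eq_iff zshift_def inv_shift)

lemma zshift_eq_0_iff [simp]: "zshift k p = 0 \<longleftrightarrow> p = 0"
  by (metis add.left_inverse zshift_0 zshift_zero zshift_zshift)

lemma degree_zshift [simp]: "degree (zshift k p) = degree p"
  by (simp add: zshift_def degree_pcompose)

lemma lead_coeff_zshift [simp]: "coeff (zshift k p) (degree p) = lead_coeff p"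
proof -
  have "lead_coeff (zshift k p) = lead_coeff p"
    unfolding zshift_def by (subst lead_coeff_comp) auto
  then show ?thesis by simp
qed

lemma zshift_diff_low:
  assumes "zshift k p - p \<noteq> 0"
  shows "degree (zshift k p - p) < degree p"
proof -
  have le: "degree (zshift k p - p) \<le> degree p"
    by (rule order.trans [OF degree_diff_le_max]) simp
  have "coeff (zshift k p - p) (degree p) = 0" by simp
  moreover have "coeff (zshift k p - p) (degree (zshift k p - p)) \<noteq> 0"
    using assms leading_coeff_neq_0 by blast
  ultimately show ?thesis using le by (metis le_neq_implies_less)
qed

lemma poly_zshift: "poly (zshift k p) c = poly p (c - of_int k)"
  by (simp add: zshift_def poly_pcompose)

text \<open>
  The roots of \<open>p\<close> are split off one by one. If \<open>p = (z - c) p'\<close> and \<open>e = q(c)\<close>, then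
  \<open>e = q - (z - c) t\<close> for some \<open>t\<close>, and multiplying a Bezout identity for \<open>p'\<close> and \<open>q\<close> by this
  nonzero constant turns the multiple of \<open>p'\<close> into a multiple of \<open>p\<close> modulo \<open>q\<close>.
\<close>

lemma bezout_if_no_common_root:
  fixes p q :: "'k::alg_closed_field poly"
  assumes "p \<noteq> 0" and "\<And>c. poly p c = 0 \<Longrightarrow> poly q c \<noteq> 0"
  shows "\<exists>u v. u * p + v * q = 1"
  using assms
proof (induction "degree p" arbitrary: p)
  case 0
  then obtain c where "p = [:c:]" "c \<noteq> 0" by (metis degree_eq_zeroE pCons_0_0)
  then have "[:inverse c:] * p + 0 * q = 1" by (simp add: one_pCons)
  then show ?case by blast
next
  case (Suc d)
  then obtain c where c: "poly p c = 0"
    using alg_closed_imp_poly_has_root[of p] by auto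
  then obtain p' where p': "p = [:- c, 1:] * p'" by (auto simp: poly_eq_0_iff_dvd)
  with Suc.prems have "p' \<noteq> 0" by auto
  then have "degree p = Suc (degree p')" by (simp add: p' degree_mult_eq del: mult_pCons_left)
  moreover have "\<And>b. poly p' b = 0 \<Longrightarrow> poly q b \<noteq> 0" using Suc.prems by (auto simp: p')
  ultimately obtain u v where uv: "u * p' + v * q = 1"
    using Suc.hyps \<open>p' \<noteq> 0\<close> by (metis nat.inject)
  define e where "e = poly q c"
  have "e \<noteq> 0" using Suc.prems c by (auto simp: e_def)
  have "poly (q - [:e:]) c = 0" by (simp add: e_def)
  then obtain t where t: "q - [:e:] = [:- c, 1:] * t" unfolding poly_eq_0_iff_dvd by (rule dvdE)
  have e: "[:e:] = q - [:- c, 1:] * t" using t by (metis add_diff_cancel_left' diff_eq_eq)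
  have "[:e:] = [:e:] * (u * p' + v * q)" by (simp add: uv)
  also have "\<dots> = (q - [:- c, 1:] * t) * (u * p') + [:e:] * v * q"
    by (simp only: e [symmetric]) (simp add: algebra_simps)
  also have "\<dots> = (- u * t) * p + (u * p' + [:e:] * v) * q"
    by (simp add: p' algebra_simps)
  finally have "[:inverse e:] * [:e:] = [:inverse e:] * ((- u * t) * p + (u * p' + [:e:] * v) * q)"
    by (rule arg_cong)
  moreover have "[:inverse e:] * [:e:] = 1" using \<open>e \<noteq> 0\<close> by (simp add: one_pCons)
  ultimately have "1 = [:inverse e:] * ((- u * t) * p + (u * p' + [:e:] * v) * q)" by metis
  also have "\<dots> = ([:inverse e:] * (- u * t)) * p + ([:inverse e:] * (u * p' + [:e:] * v)) * q"
    by (simp only: distrib_left distrib_right mult.assoc)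
  finally have "([:inverse e:] * (- u * t)) * p + ([:inverse e:] * (u * p' + [:e:] * v)) * q = 1" ..
  then show ?case by blast
qed

section \<open>Skew Laurent polynomials\<close>

text \<open>
  A finitely supported family of polynomials \<open>p\<^sub>k\<close> stands for \<open>\<Sum> p\<^sub>k x\<^sup>k\<close>, with coefficients on the left.
\<close>

typedef (overloaded) 'k skew_laurent = "UNIV :: (int \<Rightarrow>\<^sub>0 'k::zero poly) set"
  morphisms scoeffs Skew by simp

lemmas scoeffs_Skew [simp] = Skew_inverse [OF UNIV_I]

definition scoeff :: "'k::zero skew_laurent \<Rightarrow> int \<Rightarrow> 'k poly" where
  "scoeff s = Poly_Mapping.lookup (scoeffs s)"

definition supp :: "'k::zero skew_laurent \<Rightarrow> int set" where
  "supp s = Poly_Mapping.keys (scoeffs s)"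

lemma finite_supp [simp]: "finite (supp s)"
  by (simp add: supp_def)

lemma in_supp_iff: "k \<in> supp s \<longleftrightarrow> scoeff s k \<noteq> 0"
  by (simp add: supp_def scoeff_def in_keys_iff)

lemma skew_eqI: "(\<And>k. scoeff s k = scoeff t k) \<Longrightarrow> s = t"
  by (simp add: scoeff_def poly_mapping_eq_iff scoeffs_inject [symmetric] fun_eq_iff)

definition smono :: "'k::zero poly \<Rightarrow> int \<Rightarrow> 'k skew_laurent" where
  "smono p k = Skew (Poly_Mapping.single k p)"

lemma scoeff_smono: "scoeff (smono p k) l = (if l = k then p else 0)"
  by (simp add: scoeff_def smono_def lookup_single when_def)

lemma scoeff_smono_same [simp]: "scoeff (smono p k) k = p"
  by (simp add: scoeff_smono)

instantiation skew_laurent :: (field_char_0) ring_1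
begin

definition "0 = Skew 0"
definition "1 = smono 1 0"
definition "s + t = Skew (scoeffs s + scoeffs t)"
definition "s - t = Skew (scoeffs s - scoeffs t)"
definition "- s = Skew (- scoeffs s)"
definition "s * t =
  Skew (\<Sum>k\<in>supp s. \<Sum>l\<in>supp t. Poly_Mapping.single (k + l) (scoeff s k * zshift k (scoeff t l)))"

lemma scoeff_0 [simp]: "scoeff 0 k = 0"
  and scoeff_add [simp]: "scoeff (s + t) k = scoeff s k + scoeff t k"
  and scoeff_diff [simp]: "scoeff (s - t) k = scoeff s k - scoeff t k"
  and scoeff_uminus [simp]: "scoeff (- s) k = - scoeff s k"
  by (simp_all add: zero_skew_laurent_def plus_skew_laurent_def minus_skew_laurent_def
      uminus_skew_laurent_def scoeff_def lookup_add lookup_minus)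

lemma scoeff_1: "scoeff 1 k = (if k = 0 then 1 else 0)"
  by (simp add: one_skew_laurent_def scoeff_smono)

text \<open>
  The index set may be any finite set containing the support, so that products with different left
  factors can be expanded over the same set.
\<close>

lemma scoeff_mult:
  assumes "finite K" and "supp s \<subseteq> K"
  shows "scoeff (s * t) m = (\<Sum>k\<in>K. scoeff s k * zshift k (scoeff t (m - k)))"
proof -
  have "scoeff (s * t) m =
    (\<Sum>k\<in>supp s. \<Sum>l\<in>supp t. if k + l = m then scoeff s k * zshift k (scoeff t l) else 0)"
    unfolding times_skew_laurent_def scoeff_def [of "Skew _"]
    by (auto simp: lookup_sum lookup_single when_def intro!: sum.cong)
  also have "\<dots> = (\<Sum>k\<in>supp s. scoeff s k * zshift k (scoeff t (m - k)))"
  proof (rule sum.cong [OF refl])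
    fix k
    have "k + l = m \<longleftrightarrow> l = m - k" for l by auto
    then show "(\<Sum>l\<in>supp t. if k + l = m then scoeff s k * zshift k (scoeff t l) else 0) =
      scoeff s k * zshift k (scoeff t (m - k))"
      using sum.delta [of "supp t" "m - k" "\<lambda>l. scoeff s k * zshift k (scoeff t l)"]
      by (cases "m - k \<in> supp t") (simp_all only: in_supp_iff finite_supp if_True if_False
          not_not zshift_0 mult_zero_right simp_thms)
  qed
  also have "\<dots> = (\<Sum>k\<in>K. scoeff s k * zshift k (scoeff t (m - k)))"
    by (rule sum.mono_neutral_left) (use assms in \<open>auto simp: in_supp_iff\<close>)
  finally show ?thesis .
qed

instance
proof
  fix s t u :: "'a skew_laurent"
  show "s * t * u = s * (t * u)"
  proof (rule skew_eqI)
    fix m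
    define K where "K = (\<lambda>(i, j). i + j) ` (supp s \<times> supp t)"
    have fin: "finite K" by (simp add: K_def)
    have sub: "supp (s * t) \<subseteq> K"
    proof
      fix k assume "k \<in> supp (s * t)"
      then have "(\<Sum>i\<in>supp s. scoeff s i * zshift i (scoeff t (k - i))) \<noteq> 0"
        by (simp add: in_supp_iff scoeff_mult [OF finite_supp order_refl])
      then obtain i where "i \<in> supp s" "scoeff s i * zshift i (scoeff t (k - i)) \<noteq> 0"
        by (meson sum.not_neutral_contains_not_neutral)
      then have "(i, k - i) \<in> supp s \<times> supp t" by (auto simp: in_supp_iff)
      then show "k \<in> K" unfolding K_def by (force intro!: image_eqI [where x = "(i, k - i)"])
    qed
    have inner: "(\<Sum>k\<in>K. zshift i (scoeff t (k - i)) * zshift k (scoeff u (m - k))) =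
      zshift i (scoeff (t * u) (m - i))" if i: "i \<in> supp s" for i
    proof -
      have "zshift i (scoeff (t * u) (m - i)) =
        (\<Sum>j\<in>supp t. zshift i (scoeff t j) * zshift (i + j) (scoeff u (m - i - j)))"
        by (simp add: scoeff_mult [OF finite_supp order_refl] zshift_sum zshift_mult)
      also have "\<dots> = (\<Sum>k\<in>(+) i ` supp t. zshift i (scoeff t (k - i)) * zshift k (scoeff u (m - k)))"
        by (subst sum.reindex) (auto simp: o_def algebra_simps)
      also have "\<dots> = (\<Sum>k\<in>K. zshift i (scoeff t (k - i)) * zshift k (scoeff u (m - k)))"
      proof (rule sum.mono_neutral_left [OF fin])
        show "(+) i ` supp t \<subseteq> K" using i by (auto simp: K_def)
        show "\<forall>k\<in>K - (+) i ` supp t. zshift i (scoeff t (k - i)) * zshift k (scoeff u (m - k)) = 0"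
        proof
          fix k assume "k \<in> K - (+) i ` supp t"
          moreover have "k = i + (k - i)" by simp
          ultimately have "k - i \<notin> supp t" by (metis DiffD2 imageI)
          then show "zshift i (scoeff t (k - i)) * zshift k (scoeff u (m - k)) = 0"
            by (simp add: in_supp_iff)
        qed
      qed
      finally show ?thesis by simp
    qed
    have "scoeff (s * t * u) m =
      (\<Sum>k\<in>K. \<Sum>i\<in>supp s. scoeff s i * (zshift i (scoeff t (k - i)) * zshift k (scoeff u (m - k))))"
      by (simp add: scoeff_mult [OF fin sub] scoeff_mult [of "supp s" s t] sum_distrib_right mult.assoc)
    also have "\<dots> = (\<Sum>i\<in>supp s. scoeff s i * zshift i (scoeff (t * u) (m - i)))"
      by (subst sum.swap) (simp add: sum_distrib_left [symmetric] inner)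
    also have "\<dots> = scoeff (s * (t * u)) m"
      by (simp add: scoeff_mult [OF finite_supp order_refl])
    finally show "scoeff (s * t * u) m = scoeff (s * (t * u)) m" .
  qed
  show "(s + t) * u = s * u + t * u"
  proof (rule skew_eqI)
    fix m
    define K where "K = supp s \<union> supp t"
    have "finite K" "supp s \<subseteq> K" "supp t \<subseteq> K" by (auto simp: K_def)
    moreover have "supp (s + t) \<subseteq> K" by (auto simp: K_def in_supp_iff)
    ultimately show "scoeff ((s + t) * u) m = scoeff (s * u + t * u) m"
      by (simp add: scoeff_mult [of K] distrib_right sum.distrib)
  qed
  show "s * (t + u) = s * t + s * u"
    by (rule skew_eqI)
      (simp add: scoeff_mult [OF finite_supp order_refl] zshift_add distrib_left sum.distrib)
  show "1 * s = s"
    by (rule skew_eqI)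
      (simp add: scoeff_mult [of "{0}" 1] scoeff_1 subset_iff in_supp_iff)
  show "s * 1 = s"
  proof (rule skew_eqI)
    fix m
    have eq: "scoeff s k * zshift k (scoeff 1 (m - k)) = (if k = m then scoeff s m else 0)" for k
      by (auto simp: scoeff_1)
    have "scoeff (s * 1) m = (\<Sum>k\<in>insert m (supp s). scoeff s k * zshift k (scoeff 1 (m - k)))"
      by (rule scoeff_mult) auto
    also have "\<dots> = scoeff s m" by (simp only: eq) simp
    finally show "scoeff (s * 1) m = scoeff s m" .
  qed
  show "(0::'a skew_laurent) \<noteq> 1"
    by (metis scoeff_0 scoeff_1 zero_neq_one)
qed (rule skew_eqI; simp add: algebra_simps)+

end

lemma scoeff_sum: "scoeff (sum f A) k = (\<Sum>i\<in>A. scoeff (f i) k)"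
  by (induction A rule: infinite_finite_induct) auto

lemma scoeff_smono_mult: "scoeff (smono p k * s) m = p * zshift k (scoeff s (m - k))"
proof -
  have "supp (smono p k) \<subseteq> {k}" by (auto simp: in_supp_iff scoeff_smono split: if_splits)
  then show ?thesis by (simp add: scoeff_mult [of "{k}"])
qed

lemma scoeff_mult_smono: "scoeff (s * smono p k) m = scoeff s (m - k) * zshift (m - k) p"
proof -
  have "scoeff (s * smono p k) m =
    (\<Sum>i\<in>insert (m - k) (supp s). if i = m - k then scoeff s i * zshift i p else 0)"
    by (subst scoeff_mult [of "insert (m - k) (supp s)"])
      (auto simp: scoeff_smono algebra_simps intro!: sum.cong)
  then show ?thesis by simp
qed

lemma smono_mult_smono: "smono p k * smono q l = smono (p * zshift k q) (k + l)"
  by (rule skew_eqI) (auto simp: scoeff_smono_mult scoeff_smono)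

lemma smono_0 [simp]: "smono 0 k = 0"
  by (rule skew_eqI) (simp add: scoeff_smono)

lemma smono_add: "smono (p + q) k = smono p k + smono q k"
  and smono_diff: "smono (p - q) k = smono p k - smono q k"
  by (rule skew_eqI; simp add: scoeff_smono)+

lemma smono_1_0: "smono 1 0 = 1"
  by (simp add: one_skew_laurent_def)

lemma smono_eq_0_iff [simp]: "smono p k = 0 \<longleftrightarrow> p = 0"
  by (metis scoeff_0 scoeff_smono_same smono_0)

lemma supp_eq_empty_iff [simp]: "supp s = {} \<longleftrightarrow> s = 0"
proof
  assume "supp s = {}"
  then show "s = 0" by (intro skew_eqI) (simp add: in_supp_iff set_eq_iff)
qed (auto simp: in_supp_iff)

lemma skew_eq_sum_smono: "s = (\<Sum>k\<in>supp s. smono (scoeff s k) k)"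
proof (rule skew_eqI)
  fix m
  have "scoeff (\<Sum>k\<in>supp s. smono (scoeff s k) k) m = (\<Sum>k\<in>supp s. if k = m then scoeff s m else 0)"
    by (auto simp: scoeff_sum scoeff_smono intro!: sum.cong)
  also have "\<dots> = scoeff s m" by (simp add: in_supp_iff)
  finally show "scoeff s m = scoeff (\<Sum>k\<in>supp s. smono (scoeff s k) k) m" by simp
qed

section \<open>The degree of a skew Laurent polynomial\<close>

text \<open>
  The weight of \<open>z\<close> is \<open>2\<close> and that of \<open>x\<close> is \<open>n\<close>, hence \<open>x\<^sup>-\<^sup>1\<close> has weight \<open>- n\<close>.
\<close>

definition wt :: "nat \<Rightarrow> 'k::zero skew_laurent \<Rightarrow> int \<Rightarrow> int" where
  "wt n s k = 2 * int (degree (scoeff s k)) + int n * k"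

text \<open>
  The degree of \<open>0\<close> is the maximum of the empty set, an unspecified number.
\<close>

definition sdeg :: "nat \<Rightarrow> 'k::zero skew_laurent \<Rightarrow> int" where
  "sdeg n s = Max (wt n s ` supp s)"

lemma wt_le_sdeg: "k \<in> supp s \<Longrightarrow> wt n s k \<le> sdeg n s"
  by (simp add: sdeg_def)

lemma sdeg_attained:
  assumes "s \<noteq> 0"
  obtains k where "k \<in> supp s" "wt n s k = sdeg n s"
proof -
  have "sdeg n s \<in> wt n s ` supp s"
    unfolding sdeg_def using assms by (intro Max_in) auto
  then show thesis using that by auto
qed

lemma sdeg_less_iff: "s \<noteq> 0 \<Longrightarrow> sdeg n s < m \<longleftrightarrow> (\<forall>k\<in>supp s. wt n s k < m)"
  and sdeg_le_iff: "s \<noteq> 0 \<Longrightarrow> sdeg n s \<le> m \<longleftrightarrow> (\<forall>k\<in>supp s. wt n s k \<le> m)"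
  by (simp_all add: sdeg_def)

text \<open>
  Among the terms of maximal weight, the one with the largest exponent of \<open>x\<close> plays the part of a
  leading term in the proof that the degree is additive.
\<close>

lemma sdeg_eq_last:
  assumes "s \<noteq> 0"
  obtains k where "k \<in> supp s" "wt n s k = sdeg n s"
    "\<And>l. l \<in> supp s \<Longrightarrow> k < l \<Longrightarrow> wt n s l < sdeg n s"
proof -
  define K where "K = {k \<in> supp s. wt n s k = sdeg n s}"
  have "finite K" "K \<noteq> {}" using sdeg_attained [OF assms] by (auto simp: K_def)
  then have "Max K \<in> K" by (rule Max_in)
  moreover have "wt n s l < sdeg n s" if "l \<in> supp s" "Max K < l" for l
  proof -
    have "l \<notin> K" using that Max_ge [OF \<open>finite K\<close>, of l] by auto
    then show ?thesis using that wt_le_sdeg [of l s n] by (auto simp: K_def)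
  qed
  ultimately show thesis using that by (auto simp: K_def)
qed

lemma degree_mult_zshift:
  assumes "p \<noteq> 0" "q \<noteq> 0"
  shows "degree (p * zshift k q) = degree p + degree q"
  using assms by (simp add: degree_mult_eq)

lemma wt_mult_le:
  assumes "m \<in> supp (s * t)"
  shows "wt n (s * t) m \<le> sdeg n s + sdeg n t"
proof -
  have "2 * int (degree (scoeff (s * t) m)) \<le> sdeg n s + sdeg n t - int n * m"
  proof -
    define D where "D = sdeg n s + sdeg n t - int n * m"
    have *: "scoeff s k * zshift k (scoeff t (m - k)) = 0 \<or>
        2 * int (degree (scoeff s k * zshift k (scoeff t (m - k)))) \<le> D" for k
    proof (cases "k \<in> supp s \<and> m - k \<in> supp t")
      case True
      then have "wt n s k \<le> sdeg n s" "wt n t (m - k) \<le> sdeg n t" by (auto intro: wt_le_sdeg)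
      moreover have "degree (scoeff s k * zshift k (scoeff t (m - k))) =
          degree (scoeff s k) + degree (scoeff t (m - k))"
        using True by (intro degree_mult_zshift) (auto simp: in_supp_iff)
      ultimately show ?thesis by (auto simp: wt_def D_def algebra_simps)
    next
      case False
      then show ?thesis by (auto simp: in_supp_iff)
    qed
    have ne: "scoeff (s * t) m \<noteq> 0" using assms by (simp add: in_supp_iff)
    then obtain k where "scoeff s k * zshift k (scoeff t (m - k)) \<noteq> 0"
      unfolding scoeff_mult [OF finite_supp order_refl] by (meson sum.not_neutral_contains_not_neutral)
    then have "0 \<le> D" using * [of k] by linarith
    have "degree (scoeff (s * t) m) \<le> nat (D div 2)"
      unfolding scoeff_mult [OF finite_supp order_refl]
    proof (rule degree_sum_le)
      fix k
      show "degree (scoeff s k * zshift k (scoeff t (m - k))) \<le> nat (D div 2)"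
        using * [of k] \<open>0 \<le> D\<close> by auto
    qed simp
    then show ?thesis using \<open>0 \<le> D\<close> unfolding D_def [symmetric] by linarith
  qed
  then show ?thesis by (simp add: wt_def)
qed

text \<open>
  The product of the leading terms of \<open>s\<close> and \<open>t\<close> cannot cancel: any other pair of terms with the same
  total exponent of \<open>x\<close> has a larger exponent in one of the two factors, hence smaller weight there.
\<close>

lemma
  assumes "s \<noteq> 0" "t \<noteq> 0"
  shows skew_mult_nonzero: "s * t \<noteq> 0"
    and sdeg_mult: "sdeg n (s * t) = sdeg n s + sdeg n t"
proof -
  have *: "s * t \<noteq> 0 \<and> sdeg n (s * t) = sdeg n s + sdeg n t" for n
  proof -
    obtain k where k: "k \<in> supp s" "wt n s k = sdeg n s"
      "\<And>l. l \<in> supp s \<Longrightarrow> k < l \<Longrightarrow> wt n s l < sdeg n s" using sdeg_eq_last [OF assms(1)] by metis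
    obtain l where l: "l \<in> supp t" "wt n t l = sdeg n t"
      "\<And>i. i \<in> supp t \<Longrightarrow> l < i \<Longrightarrow> wt n t i < sdeg n t" using sdeg_eq_last [OF assms(2)] by metis
    define D where "D = degree (scoeff s k) + degree (scoeff t l)"
    have nz: "scoeff s k \<noteq> 0" "scoeff t l \<noteq> 0" using k l by (auto simp: in_supp_iff)
    have other: "coeff (scoeff s i * zshift i (scoeff t (k + l - i))) D = 0" if "i \<noteq> k" for i
    proof (cases "i \<in> supp s \<and> k + l - i \<in> supp t")
      case True
      have "wt n s i + wt n t (k + l - i) < sdeg n s + sdeg n t"
      proof (cases "k < i")
        case True
        then show ?thesis using k(3) [of i] wt_le_sdeg [of "k + l - i" t n] \<open>i \<in> supp s \<and> _\<close> by force
      next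
        case False
        then have "l < k + l - i" using \<open>i \<noteq> k\<close> by simp
        then show ?thesis using l(3) [of "k + l - i"] wt_le_sdeg [of i s n] \<open>i \<in> supp s \<and> _\<close> by force
      qed
      then have "degree (scoeff s i) + degree (scoeff t (k + l - i)) < D"
        unfolding k(2) [symmetric] l(2) [symmetric] wt_def D_def by (simp add: algebra_simps)
      moreover have "degree (scoeff s i * zshift i (scoeff t (k + l - i))) =
          degree (scoeff s i) + degree (scoeff t (k + l - i))"
        using True by (intro degree_mult_zshift) (auto simp: in_supp_iff)
      ultimately show ?thesis by (simp add: coeff_eq_0)
    qed (auto simp: in_supp_iff)
    have "coeff (scoeff (s * t) (k + l)) D =
      (\<Sum>i\<in>supp s. coeff (scoeff s i * zshift i (scoeff t (k + l - i))) D)"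
      by (simp add: scoeff_mult [OF finite_supp order_refl] coeff_sum)
    also have "\<dots> = (\<Sum>i\<in>supp s. if i = k then coeff (scoeff s k * zshift k (scoeff t l)) D else 0)"
      using other by (intro sum.cong) auto
    also have "\<dots> = lead_coeff (scoeff s k) * lead_coeff (scoeff t l)"
      using k(1) coeff_mult_degree_sum [of "scoeff s k" "zshift k (scoeff t l)"] by (simp add: D_def)
    finally have nzc: "coeff (scoeff (s * t) (k + l)) D \<noteq> 0" using nz by simp
    then have mem: "k + l \<in> supp (s * t)" by (auto simp: in_supp_iff)
    then have st: "s * t \<noteq> 0" by (auto simp: in_supp_iff)
    have "D \<le> degree (scoeff (s * t) (k + l))" using nzc by (rule le_degree)
    then have "sdeg n s + sdeg n t \<le> wt n (s * t) (k + l)"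
      unfolding k(2) [symmetric] l(2) [symmetric] wt_def D_def by (simp add: algebra_simps)
    also have "\<dots> \<le> sdeg n (s * t)" using mem by (rule wt_le_sdeg)
    finally show ?thesis
      using st wt_mult_le [of _ s t n] by (auto intro: antisym simp: sdeg_le_iff)
  qed
  show "s * t \<noteq> 0" "sdeg n (s * t) = sdeg n s + sdeg n t" using * by auto
qed

instance skew_laurent :: (field_char_0) ring_1_no_zero_divisors
  by standard (rule skew_mult_nonzero)

text \<open>
  This holds of \<open>0\<close> for every \<open>m\<close>, so it is closed under addition, unlike a bound on \<open>sdeg\<close>.
\<close>

definition deg_below :: "nat \<Rightarrow> int \<Rightarrow> 'k::zero skew_laurent \<Rightarrow> bool" where
  "deg_below n m s \<longleftrightarrow> (\<forall>k\<in>supp s. wt n s k < m)"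

lemma deg_below_iff: "deg_below n m s \<longleftrightarrow> s = 0 \<or> sdeg n s < m"
  by (cases "s = 0") (auto simp: deg_below_def sdeg_less_iff in_supp_iff)

lemma deg_below_iff_degree:
  "deg_below n m s \<longleftrightarrow> (\<forall>k. scoeff s k = 0 \<or> 2 * int (degree (scoeff s k)) < m - int n * k)"
  by (auto simp: deg_below_def wt_def in_supp_iff algebra_simps)

lemma deg_below_add:
  assumes "deg_below n m s" "deg_below n m t"
  shows "deg_below n m (s + t)"
  unfolding deg_below_iff_degree
proof
  fix k
  have "degree (scoeff s k + scoeff t k) \<le> max (degree (scoeff s k)) (degree (scoeff t k))"
    by (rule degree_add_le_max)
  moreover have "scoeff s k = 0 \<or> 2 * int (degree (scoeff s k)) < m - int n * k"
    "scoeff t k = 0 \<or> 2 * int (degree (scoeff t k)) < m - int n * k"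
    using assms by (auto simp: deg_below_iff_degree)
  ultimately show "scoeff (s + t) k = 0 \<or> 2 * int (degree (scoeff (s + t) k)) < m - int n * k"
    by auto
qed

lemma deg_below_uminus: "deg_below n m s \<Longrightarrow> deg_below n m (- s)"
  by (simp add: deg_below_iff_degree)

lemma deg_below_diff: "deg_below n m s \<Longrightarrow> deg_below n m t \<Longrightarrow> deg_below n m (s - t)"
  using deg_below_add [of n m s "- t"] deg_below_uminus [of n m t] by simp

lemma deg_below_sum: "(\<And>i. i \<in> A \<Longrightarrow> deg_below n m (f i)) \<Longrightarrow> deg_below n m (sum f A)"
  by (induction A rule: infinite_finite_induct) (simp_all add: deg_below_add deg_below_iff [of _ _ 0])

lemma deg_below_mult_right: "deg_below n m s \<Longrightarrow> t \<noteq> 0 \<Longrightarrow> deg_below n (m + sdeg n t) (s * t)"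
  by (cases "s = 0") (auto simp: deg_below_iff sdeg_mult)

text \<open>
  For monomials \<open>p x\<^sup>k\<close> and \<open>q x\<^sup>l\<close> the commutator is
  \<open>(p (\<sigma>\<^sup>k(q) - q) - q (\<sigma>\<^sup>l(p) - p)) x\<^sup>k\<^sup>+\<^sup>l\<close>, and a shift preserves the leading term of a polynomial.
\<close>

lemma deg_below_commutator:
  fixes s t :: "'k::field_char_0 skew_laurent"
  assumes "s \<noteq> 0" "t \<noteq> 0"
  shows "deg_below n (sdeg n s + sdeg n t) (s * t - t * s)"
proof -
  have mono: "deg_below n m (smono p k * smono q l - smono q l * smono p k)"
    if "p \<noteq> 0" "q \<noteq> 0" and m: "2 * int (degree p) + int n * k + (2 * int (degree q) + int n * l) \<le> m"
    for p q :: "'k poly" and k l m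
  proof -
    have "smono p k * smono q l - smono q l * smono p k =
        smono (p * (zshift k q - q)) (k + l) - smono (q * (zshift l p - p)) (k + l)"
      by (simp add: smono_mult_smono smono_diff [symmetric] algebra_simps)
    moreover have "deg_below n m (smono (p * (zshift k q - q)) (k + l))"
    proof (cases "zshift k q - q = 0")
      case False
      then have "degree (p * (zshift k q - q)) < degree p + degree q"
        using zshift_diff_low [OF False] \<open>p \<noteq> 0\<close> by (simp add: degree_mult_eq)
      then show ?thesis using m by (auto simp: deg_below_iff_degree scoeff_smono distrib_left)
    qed (simp add: deg_below_iff)
    moreover have "deg_below n m (smono (q * (zshift l p - p)) (k + l))"
    proof (cases "zshift l p - p = 0")
      case False
      then have "degree (q * (zshift l p - p)) < degree p + degree q"
        using zshift_diff_low [OF False] \<open>q \<noteq> 0\<close> by (simp add: degree_mult_eq)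
      then show ?thesis using m by (auto simp: deg_below_iff_degree scoeff_smono distrib_left)
    qed (simp add: deg_below_iff)
    ultimately show ?thesis by (simp add: deg_below_diff)
  qed
  have "s * t = (\<Sum>k\<in>supp s. \<Sum>l\<in>supp t. smono (scoeff s k) k * smono (scoeff t l) l)"
    by (subst skew_eq_sum_smono [of s], subst skew_eq_sum_smono [of t]) (simp add: sum_product)
  moreover have "t * s = (\<Sum>k\<in>supp s. \<Sum>l\<in>supp t. smono (scoeff t l) l * smono (scoeff s k) k)"
    by (subst skew_eq_sum_smono [of s], subst skew_eq_sum_smono [of t], subst sum.swap)
      (simp add: sum_product)
  ultimately have "s * t - t * s = (\<Sum>k\<in>supp s. \<Sum>l\<in>supp t.
      smono (scoeff s k) k * smono (scoeff t l) l - smono (scoeff t l) l * smono (scoeff s k) k)"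
    by (simp add: sum_subtractf)
  also have "deg_below n (sdeg n s + sdeg n t) \<dots>"
  proof (intro deg_below_sum mono)
    fix k l assume "k \<in> supp s" "l \<in> supp t"
    then show "2 * int (degree (scoeff s k)) + int n * k + (2 * int (degree (scoeff t l)) + int n * l)
        \<le> sdeg n s + sdeg n t"
      using wt_le_sdeg [of k s n] wt_le_sdeg [of l t n] by (simp add: wt_def)
  qed (auto simp: in_supp_iff)
  finally show ?thesis .
qed

section \<open>Finite groups acting on a domain by outer automorphisms\<close>

text \<open>
  The last axiom says that \<open>g\<close> is not conjugation by an element of the division ring of fractions, in a
  form without fractions. If \<open>g(c) = r\<^sup>-\<^sup>1 d c d\<^sup>-\<^sup>1 r\<close> for all \<open>c\<close>, then \<open>c = b d\<close> gives
  \<open>r g(b) g(d) = d b r\<close>.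
\<close>

locale outer_action = group \<G> for \<G> :: "('i, 'm) monoid_scheme" (structure) +
  fixes B :: "'s::ring_1_no_zero_divisors set" and act :: "'i \<Rightarrow> 's \<Rightarrow> 's"
  assumes fin: "finite (carrier \<G>)"
    and one_B: "1 \<in> B"
    and diff_B: "b \<in> B \<Longrightarrow> c \<in> B \<Longrightarrow> b - c \<in> B"
    and mult_B: "b \<in> B \<Longrightarrow> c \<in> B \<Longrightarrow> b * c \<in> B"
    and act_B: "g \<in> carrier \<G> \<Longrightarrow> b \<in> B \<Longrightarrow> act g b \<in> B"
    and act_add: "g \<in> carrier \<G> \<Longrightarrow> b \<in> B \<Longrightarrow> c \<in> B \<Longrightarrow> act g (b + c) = act g b + act g c"
    and act_mult: "g \<in> carrier \<G> \<Longrightarrow> b \<in> B \<Longrightarrow> c \<in> B \<Longrightarrow> act g (b * c) = act g b * act g c"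
    and act_1: "g \<in> carrier \<G> \<Longrightarrow> act g 1 = 1"
    and act_id: "b \<in> B \<Longrightarrow> act \<one> b = b"
    and act_comp: "g \<in> carrier \<G> \<Longrightarrow> h \<in> carrier \<G> \<Longrightarrow> b \<in> B \<Longrightarrow> act (g \<otimes> h) b = act g (act h b)"
    and outer: "g \<in> carrier \<G> \<Longrightarrow> g \<noteq> \<one> \<Longrightarrow> r \<in> B \<Longrightarrow> d \<in> B \<Longrightarrow> r \<noteq> 0 \<Longrightarrow> d \<noteq> 0 \<Longrightarrow>
      \<exists>b\<in>B. r * act g b * act g d \<noteq> d * b * r"
begin

lemma zero_B: "0 \<in> B"
  using diff_B [OF one_B one_B] by simp

lemma uminus_B: "b \<in> B \<Longrightarrow> - b \<in> B"
  using diff_B [OF zero_B] by simp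

lemma add_B: "b \<in> B \<Longrightarrow> c \<in> B \<Longrightarrow> b + c \<in> B"
  using diff_B [of b "- c"] uminus_B by simp

lemma sum_B: "(\<And>i. i \<in> A \<Longrightarrow> f i \<in> B) \<Longrightarrow> sum f A \<in> B"
  by (induction A rule: infinite_finite_induct) (auto simp: zero_B add_B)

lemma act_0: "g \<in> carrier \<G> \<Longrightarrow> act g 0 = 0"
  using act_add [OF _ zero_B zero_B, of g] by simp

lemma act_sum:
  "g \<in> carrier \<G> \<Longrightarrow> (\<And>i. i \<in> A \<Longrightarrow> f i \<in> B) \<Longrightarrow> act g (sum f A) = (\<Sum>i\<in>A. act g (f i))"
  by (induction A rule: infinite_finite_induct) (auto simp: act_0 act_add sum_B)

lemma act_inv_act: "g \<in> carrier \<G> \<Longrightarrow> b \<in> B \<Longrightarrow> act (inv g) (act g b) = b"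
  and act_act_inv: "g \<in> carrier \<G> \<Longrightarrow> b \<in> B \<Longrightarrow> act g (act (inv g) b) = b"
  by (simp_all add: act_comp [symmetric] act_id)

text \<open>
  The Auslander map: a function \<open>f\<close> on the group stands for the element \<open>\<Sum> f(g) # g\<close> of the skew
  group ring.
\<close>

definition aus :: "('i \<Rightarrow> 's) \<Rightarrow> 's \<Rightarrow> 's" where
  "aus f b = (\<Sum>g\<in>carrier \<G>. f g * act g b)"

lemma sum_translate:
  assumes "h \<in> carrier \<G>"
  shows "(\<Sum>g\<in>carrier \<G>. F (g \<otimes> h)) = (\<Sum>g\<in>carrier \<G>. F g)"
  using assms
  by (intro sum.reindex_bij_witness [of _ "\<lambda>g. g \<otimes> inv h" "\<lambda>g. g \<otimes> h"]) (auto simp: m_assoc)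

lemma sum_translate_left:
  assumes "h \<in> carrier \<G>"
  shows "(\<Sum>g\<in>carrier \<G>. F (h \<otimes> g)) = (\<Sum>g\<in>carrier \<G>. F g)"
  using assms
  by (intro sum.reindex_bij_witness [of _ "\<lambda>g. inv h \<otimes> g" "\<lambda>g. h \<otimes> g"])
    (auto simp: m_assoc [symmetric])

text \<open>
  Closure properties shared by all two-sided ideals of the skew group ring, in terms of coefficient
  functions. The last two clauses are right multiplication by \<open>b # 1\<close> and by \<open>1 # h\<^sup>-\<^sup>1\<close>.
\<close>

definition skew_ideal :: "('i \<Rightarrow> 's) set \<Rightarrow> bool" where
  "skew_ideal I \<longleftrightarrow>
     (\<forall>f\<in>I. \<forall>g\<in>carrier \<G>. f g \<in> B) \<and>
     (\<forall>f\<in>I. \<forall>f'\<in>I. (\<lambda>g. f g - f' g) \<in> I) \<and>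
     (\<forall>f\<in>I. \<forall>b\<in>B. (\<lambda>g. b * f g) \<in> I) \<and>
     (\<forall>f\<in>I. \<forall>b\<in>B. (\<lambda>g. f g * act g b) \<in> I) \<and>
     (\<forall>f\<in>I. \<forall>h\<in>carrier \<G>. (\<lambda>g. f (g \<otimes> h)) \<in> I)"

text \<open>
  Take \<open>f\<close> in the ideal with nonempty support of minimal size and let \<open>d = f(g\<^sub>0) \<noteq> 0\<close>. For
  \<open>c = g\<^sub>0\<^sup>-\<^sup>1(b d)\<close> the element \<open>f c - d b f\<close> of the ideal vanishes at \<open>g\<^sub>0\<close> and wherever \<open>f\<close> does, so it
  is zero. At a second support point \<open>g\<close> of \<open>f\<close>, this for all \<open>b\<close> would make \<open>g g\<^sub>0\<^sup>-\<^sup>1\<close> a conjugation.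
\<close>

lemma skew_ideal_meets_B:
  assumes I: "skew_ideal I" and "f\<^sub>0 \<in> I" "h\<^sub>0 \<in> carrier \<G>" "f\<^sub>0 h\<^sub>0 \<noteq> 0"
  obtains f where "f \<in> I" "f \<one> \<noteq> 0" "\<And>g. g \<in> carrier \<G> \<Longrightarrow> g \<noteq> \<one> \<Longrightarrow> f g = 0"
proof -
  define S where "S f = {g \<in> carrier \<G>. f g \<noteq> 0}" for f :: "'i \<Rightarrow> 's"
  have fin_S: "finite (S f)" for f using fin by (simp add: S_def)
  define P where "P f \<longleftrightarrow> f \<in> I \<and> S f \<noteq> {}" for f
  have "P f\<^sub>0" using assms by (auto simp: P_def S_def)
  then obtain f where "P f" and min: "\<And>t. P t \<Longrightarrow> card (S f) \<le> card (S t)"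
    using ex_has_least_nat [of P _ "\<lambda>f. card (S f)"] by blast
  then have fI: "f \<in> I" and "S f \<noteq> {}" by (auto simp: P_def)
  then obtain g\<^sub>0 where g\<^sub>0: "g\<^sub>0 \<in> carrier \<G>" "f g\<^sub>0 \<noteq> 0" by (auto simp: S_def)
  define d where "d = f g\<^sub>0"
  have dB: "d \<in> B" using I fI g\<^sub>0 by (auto simp: skew_ideal_def d_def)
  have "f g = 0" if g: "g \<in> carrier \<G>" "g \<noteq> g\<^sub>0" for g
  proof (rule ccontr)
    assume "f g \<noteq> 0"
    have "g \<otimes> inv g\<^sub>0 \<noteq> \<one>" using g g\<^sub>0 by (metis inv_closed inv_equality inv_inv)
    moreover have "f g \<in> B" using I fI g by (auto simp: skew_ideal_def)
    ultimately obtain b where b: "b \<in> B"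
      and ne: "f g * act (g \<otimes> inv g\<^sub>0) b * act (g \<otimes> inv g\<^sub>0) d \<noteq> d * b * f g"
      using outer [of "g \<otimes> inv g\<^sub>0" "f g" d] g g\<^sub>0 dB \<open>f g \<noteq> 0\<close> by (auto simp: d_def)
    define c where "c = act (inv g\<^sub>0) (b * d)"
    have c: "c \<in> B" using b dB g\<^sub>0 by (simp add: c_def act_B mult_B)
    define t where "t h = f h * act h c - d * b * f h" for h
    have tI: "t \<in> I"
      unfolding t_def using I fI c b dB mult_B [of d b] by (simp add: skew_ideal_def)
    have "t g = f g * act (g \<otimes> inv g\<^sub>0) b * act (g \<otimes> inv g\<^sub>0) d - d * b * f g"
      using g g\<^sub>0 b dB by (simp add: t_def c_def act_comp act_mult mult_B act_B mult.assoc)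
    then have "t g \<noteq> 0" using ne by simp
    then have "P t" using tI g by (auto simp: P_def S_def)
    have "t g\<^sub>0 = 0"
      using g\<^sub>0 b dB by (simp add: t_def c_def d_def [symmetric] act_act_inv mult_B mult.assoc)
    then have "S t \<subset> S f" using g\<^sub>0 by (auto simp: S_def t_def)
    then have "card (S t) < card (S f)" by (rule psubset_card_mono [OF fin_S])
    then show False using min [OF \<open>P t\<close>] by simp
  qed
  note zero = this
  show thesis
  proof (rule that [of "\<lambda>g. f (g \<otimes> g\<^sub>0)"])
    show "(\<lambda>g. f (g \<otimes> g\<^sub>0)) \<in> I" using I fI g\<^sub>0 by (auto simp: skew_ideal_def)
    show "f (\<one> \<otimes> g\<^sub>0) \<noteq> 0" using g\<^sub>0 by simp
    show "f (g \<otimes> g\<^sub>0) = 0" if "g \<in> carrier \<G>" "g \<noteq> \<one>" for g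
      using that g\<^sub>0 by (intro zero) auto
  qed
qed

text \<open>
  The kernel is an ideal of the skew group ring. If it were nonzero, it would contain some \<open>c # 1\<close> with
  \<open>c \<noteq> 0\<close>, but this sends \<open>1\<close> to \<open>c\<close>.
\<close>

lemma aus_injective:
  assumes f: "\<And>g. g \<in> carrier \<G> \<Longrightarrow> f g \<in> B" and "\<And>b. b \<in> B \<Longrightarrow> aus f b = 0" and "g \<in> carrier \<G>"
  shows "f g = 0"
proof (rule ccontr)
  assume ne: "f g \<noteq> 0"
  define I where "I = {f. (\<forall>g\<in>carrier \<G>. f g \<in> B) \<and> (\<forall>b\<in>B. aus f b = 0)}"
  have "skew_ideal I"
    unfolding skew_ideal_def
  proof (intro conjI ballI)
    fix f assume f: "f \<in> I"
    show "f g \<in> B" if "g \<in> carrier \<G>" for g using f that by (auto simp: I_def)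
    show "(\<lambda>g. f g - f' g) \<in> I" if "f' \<in> I" for f'
      using f that by (auto simp: I_def aus_def diff_B left_diff_distrib sum_subtractf)
    show "(\<lambda>g. b * f g) \<in> I" if "b \<in> B" for b
      using f that by (auto simp: I_def aus_def mult_B mult.assoc sum_distrib_left [symmetric])
    show "(\<lambda>g. f g * act g b) \<in> I" if b: "b \<in> B" for b
    proof -
      have "aus (\<lambda>g. f g * act g b) c = aus f (b * c)" if "c \<in> B" for c
        unfolding aus_def using that b by (intro sum.cong) (auto simp: act_mult mult.assoc)
      then show ?thesis using f b by (auto simp: I_def mult_B act_B)
    qed
    show "(\<lambda>g. f (g \<otimes> h)) \<in> I" if h: "h \<in> carrier \<G>" for h
    proof -
      have "aus (\<lambda>g. f (g \<otimes> h)) c = 0" if c: "c \<in> B" for c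
      proof -
        have "aus (\<lambda>g. f (g \<otimes> h)) c = (\<Sum>g\<in>carrier \<G>. f (g \<otimes> h) * act (g \<otimes> h) (act (inv h) c))"
          unfolding aus_def using c h
          by (intro sum.cong refl) (simp add: act_comp act_B act_act_inv)
        also have "\<dots> = aus f (act (inv h) c)"
          unfolding aus_def by (rule sum_translate [OF h])
        finally show ?thesis using f c h by (auto simp: I_def act_B)
      qed
      then show ?thesis using f h by (auto simp: I_def)
    qed
  qed
  moreover have "f \<in> I" using assms by (auto simp: I_def)
  ultimately obtain k where k: "k \<in> I" "k \<one> \<noteq> 0" "\<And>g. g \<in> carrier \<G> \<Longrightarrow> g \<noteq> \<one> \<Longrightarrow> k g = 0"
    using skew_ideal_meets_B assms(3) ne by metis
  have "aus k 1 = (\<Sum>g\<in>carrier \<G>. if g = \<one> then k \<one> else 0)"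
    unfolding aus_def using k(3) by (intro sum.cong) (auto simp: act_1)
  also have "\<dots> = k \<one>" using fin by simp
  finally show False using k one_B by (auto simp: I_def)
qed

lemma aus_inj_on:
  assumes "\<And>g. g \<in> carrier \<G> \<Longrightarrow> f g \<in> B" "\<And>g. g \<in> carrier \<G> \<Longrightarrow> f' g \<in> B"
    and "\<And>b. b \<in> B \<Longrightarrow> aus f b = aus f' b" and "g \<in> carrier \<G>"
  shows "f g = f' g"
proof -
  have "aus (\<lambda>g. f g - f' g) b = 0" if "b \<in> B" for b
    using assms(3) [OF that] by (simp add: aus_def left_diff_distrib sum_subtractf)
  then have "f g - f' g = 0"
    using assms(4) by (intro aus_injective [of "\<lambda>g. f g - f' g"]) (auto simp: diff_B assms)
  then show ?thesis by simp
qed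

text \<open>
  The list \<open>(u\<^sub>1, v\<^sub>1), (u\<^sub>2, v\<^sub>2), \<dots>\<close> stands for the element \<open>\<Sum> u\<^sub>i E v\<^sub>i\<close> of the skew group ring, where
  \<open>E = \<Sum> 1 # g\<close>. These elements form the ideal generated by \<open>E\<close>, since \<open>(1 # g) E = E = E (1 # g)\<close>.
\<close>

definition tens :: "('s \<times> 's) list \<Rightarrow> 'i \<Rightarrow> 's" where
  "tens xs g = (\<Sum>(u, v)\<leftarrow>xs. u * act g v)"

definition trace :: "'s \<Rightarrow> 's" where
  "trace b = (\<Sum>g\<in>carrier \<G>. act g b)"

definition fixed :: "'s set" where
  "fixed = {b \<in> B. \<forall>g\<in>carrier \<G>. act g b = b}"

lemma tens_simps [simp]: "tens [] g = 0" "tens ((u, v) # xs) g = u * act g v + tens xs g"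
    "tens (xs @ ys) g = tens xs g + tens ys g"
  by (simp_all add: tens_def)

lemma trace_fixed: "b \<in> B \<Longrightarrow> trace b \<in> fixed"
proof -
  assume b: "b \<in> B"
  have "act h (trace b) = trace b" if h: "h \<in> carrier \<G>" for h
  proof -
    have "act h (trace b) = (\<Sum>g\<in>carrier \<G>. act (h \<otimes> g) b)"
      using b h by (simp add: trace_def act_sum act_B act_comp)
    also have "\<dots> = trace b" unfolding trace_def by (rule sum_translate_left [OF h])
    finally show ?thesis .
  qed
  then show ?thesis using b by (auto simp: fixed_def trace_def sum_B act_B)
qed

text \<open>
  The intersection of \<open>B\<close> with the ideal generated by \<open>E\<close>.
\<close>

definition tr_ideal :: "'s set" where
  "tr_ideal = {d \<in> B. \<exists>xs. set xs \<subseteq> B \<times> B \<and>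
     (\<forall>g\<in>carrier \<G>. tens xs g = (if g = \<one> then d else 0))}"

lemma tens_B: "set xs \<subseteq> B \<times> B \<Longrightarrow> g \<in> carrier \<G> \<Longrightarrow> tens xs g \<in> B"
  by (induction xs) (auto simp: zero_B add_B mult_B act_B)

lemma tens_mult_left: "tens (map (\<lambda>(u, v). (b * u, v)) xs) g = b * tens xs g"
  by (induction xs) (auto simp: distrib_left mult.assoc)

lemma tens_mult_right:
  "set xs \<subseteq> B \<times> B \<Longrightarrow> b \<in> B \<Longrightarrow> g \<in> carrier \<G> \<Longrightarrow>
    tens (map (\<lambda>(u, v). (u, v * b)) xs) g = tens xs g * act g b"
  by (induction xs) (auto simp: distrib_right mult.assoc act_mult)

lemma tens_translate:
  "set xs \<subseteq> B \<times> B \<Longrightarrow> h \<in> carrier \<G> \<Longrightarrow> g \<in> carrier \<G> \<Longrightarrow>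
    tens (map (\<lambda>(u, v). (u, act h v)) xs) g = tens xs (g \<otimes> h)"
  by (induction xs) (auto simp: act_comp)

text \<open>
  On coefficient functions, replacing all \<open>u\<^sub>i\<close> and \<open>v\<^sub>i\<close> by \<open>h(u\<^sub>i)\<close> and \<open>h(v\<^sub>i)\<close> is conjugation by
  \<open>1 # h\<close>; so the intersection of the ideal with \<open>B\<close> is stable under the group.
\<close>

lemma tens_conjugate:
  "set xs \<subseteq> B \<times> B \<Longrightarrow> h \<in> carrier \<G> \<Longrightarrow> g \<in> carrier \<G> \<Longrightarrow>
    tens (map (\<lambda>(u, v). (act h u, act h v)) xs) g = act h (tens xs (inv h \<otimes> g \<otimes> h))"
proof (induction xs)
  case (Cons x xs)
  obtain u v where x: "x = (u, v)" by (cases x)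
  have uv: "u \<in> B" "v \<in> B" and xs: "set xs \<subseteq> B \<times> B" using Cons.prems by (auto simp: x)
  have "act h (act (inv h \<otimes> g \<otimes> h) v) = act (h \<otimes> (inv h \<otimes> g \<otimes> h)) v"
    using Cons.prems uv by (simp add: act_comp)
  also have "h \<otimes> (inv h \<otimes> g \<otimes> h) = g \<otimes> h"
    using Cons.prems by (simp add: m_assoc [symmetric])
  finally have "act h (act (inv h \<otimes> g \<otimes> h) v) = act g (act h v)"
    using Cons.prems uv by (simp add: act_comp)
  then show ?case
    using Cons xs uv by (simp add: x act_add act_mult tens_B mult_B act_B)
qed (simp add: act_0)

lemma tr_ideal_subset: "d \<in> tr_ideal \<Longrightarrow> d \<in> B"
  by (simp add: tr_ideal_def)

lemma tr_ideal_mult_left: "d \<in> tr_ideal \<Longrightarrow> b \<in> B \<Longrightarrow> b * d \<in> tr_ideal"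
proof -
  assume d: "d \<in> tr_ideal" and b: "b \<in> B"
  then obtain xs where "set xs \<subseteq> B \<times> B" "\<And>g. g \<in> carrier \<G> \<Longrightarrow> tens xs g = (if g = \<one> then d else 0)"
    by (auto simp: tr_ideal_def)
  with b d show ?thesis unfolding tr_ideal_def
    by (auto simp: subset_iff mult_B tens_mult_left intro!: exI [of _ "map (\<lambda>(u, v). (b * u, v)) xs"])
qed

lemma tr_ideal_mult_right: "d \<in> tr_ideal \<Longrightarrow> b \<in> B \<Longrightarrow> d * b \<in> tr_ideal"
proof -
  assume d: "d \<in> tr_ideal" and b: "b \<in> B"
  then obtain xs where "set xs \<subseteq> B \<times> B" "\<And>g. g \<in> carrier \<G> \<Longrightarrow> tens xs g = (if g = \<one> then d else 0)"
    by (auto simp: tr_ideal_def)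
  with b d show ?thesis unfolding tr_ideal_def
    by (auto simp: subset_iff mult_B tens_mult_right act_id intro!: exI [of _ "map (\<lambda>(u, v). (u, v * b)) xs"])
qed

lemma tr_ideal_add: "d \<in> tr_ideal \<Longrightarrow> e \<in> tr_ideal \<Longrightarrow> d + e \<in> tr_ideal"
proof -
  assume d: "d \<in> tr_ideal" and e: "e \<in> tr_ideal"
  obtain xs where "set xs \<subseteq> B \<times> B" "\<And>g. g \<in> carrier \<G> \<Longrightarrow> tens xs g = (if g = \<one> then d else 0)"
    using d by (auto simp: tr_ideal_def)
  moreover obtain ys where "set ys \<subseteq> B \<times> B" "\<And>g. g \<in> carrier \<G> \<Longrightarrow> tens ys g = (if g = \<one> then e else 0)"
    using e by (auto simp: tr_ideal_def)
  ultimately show ?thesis using d e unfolding tr_ideal_def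
    by (auto simp: add_B intro!: exI [of _ "xs @ ys"])
qed

lemma tr_ideal_act: "d \<in> tr_ideal \<Longrightarrow> h \<in> carrier \<G> \<Longrightarrow> act h d \<in> tr_ideal"
proof -
  assume d: "d \<in> tr_ideal" and h: "h \<in> carrier \<G>"
  then obtain xs where xs: "set xs \<subseteq> B \<times> B" "\<And>g. g \<in> carrier \<G> \<Longrightarrow> tens xs g = (if g = \<one> then d else 0)"
    by (auto simp: tr_ideal_def)
  have "inv h \<otimes> g \<otimes> h = \<one> \<longleftrightarrow> g = \<one>" if "g \<in> carrier \<G>" for g
    using h that by (metis inv_closed inv_equality inv_inv l_inv l_one m_assoc m_closed r_one)
  then have "tens (map (\<lambda>(u, v). (act h u, act h v)) xs) g = (if g = \<one> then act h d else 0)"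
    if "g \<in> carrier \<G>" for g
    using that h xs by (simp add: tens_conjugate act_0)
  with xs h d show ?thesis unfolding tr_ideal_def
    by (auto simp: subset_iff act_B intro!: exI [of _ "map (\<lambda>(u, v). (act h u, act h v)) xs"])
qed

lemma tr_ideal_nonzero: obtains d where "d \<in> tr_ideal" "d \<noteq> 0"
proof -
  define I where "I = {f. \<exists>xs. set xs \<subseteq> B \<times> B \<and> (\<forall>g\<in>carrier \<G>. f g = tens xs g)}"
  have "skew_ideal I"
    unfolding skew_ideal_def
  proof (intro conjI ballI)
    fix f assume "f \<in> I"
    then obtain xs where xs: "set xs \<subseteq> B \<times> B" "\<And>g. g \<in> carrier \<G> \<Longrightarrow> f g = tens xs g"
      by (auto simp: I_def)
    show "f g \<in> B" if "g \<in> carrier \<G>" for g using xs that by (auto simp: tens_B)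
    show "(\<lambda>g. f g - f' g) \<in> I" if "f' \<in> I" for f'
    proof -
      obtain ys where ys: "set ys \<subseteq> B \<times> B" "\<And>g. g \<in> carrier \<G> \<Longrightarrow> f' g = tens ys g"
        using \<open>f' \<in> I\<close> by (auto simp: I_def)
      have "set (xs @ map (\<lambda>(u, v). (- 1 * u, v)) ys) \<subseteq> B \<times> B" using xs ys by (auto intro: uminus_B)
      moreover have "f g - f' g = tens (xs @ map (\<lambda>(u, v). (- 1 * u, v)) ys) g" if "g \<in> carrier \<G>" for g
        using xs ys that tens_mult_left [of "- 1" ys g] by simp
      ultimately show ?thesis unfolding I_def by blast
    qed
    show "(\<lambda>g. b * f g) \<in> I" if "b \<in> B" for b
      using xs that unfolding I_def
      by (auto simp: subset_iff mult_B tens_mult_left intro!: exI [of _ "map (\<lambda>(u, v). (b * u, v)) xs"])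
    show "(\<lambda>g. f g * act g b) \<in> I" if "b \<in> B" for b
      using xs that unfolding I_def
      by (auto simp: subset_iff mult_B tens_mult_right intro!: exI [of _ "map (\<lambda>(u, v). (u, v * b)) xs"])
    show "(\<lambda>g. f (g \<otimes> h)) \<in> I" if "h \<in> carrier \<G>" for h
      using xs that unfolding I_def
      by (auto simp: subset_iff act_B tens_translate intro!: exI [of _ "map (\<lambda>(u, v). (u, act h v)) xs"])
  qed
  moreover have "(\<lambda>g. 1) \<in> I"
    unfolding I_def using one_B by (auto simp: act_1 intro!: exI [of _ "[(1, 1)]"])
  ultimately obtain f where f: "f \<in> I" "f \<one> \<noteq> 0" "\<And>g. g \<in> carrier \<G> \<Longrightarrow> g \<noteq> \<one> \<Longrightarrow> f g = 0"
    using skew_ideal_meets_B [of I "\<lambda>g. 1" \<one>] by auto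
  then obtain xs where xs: "set xs \<subseteq> B \<times> B" "\<And>g. g \<in> carrier \<G> \<Longrightarrow> f g = tens xs g" by (auto simp: I_def)
  have "f \<one> \<in> tr_ideal"
    unfolding tr_ideal_def using xs f by (auto simp: tens_B intro!: exI [of _ xs])
  then show thesis using f that by blast
qed

text \<open>
  The ideal is stable under the group, so it contains the traces of its elements. If the trace of
  \<open>d c\<close> vanished for all \<open>c\<close>, then \<open>\<Sum> g(d) # g\<close> would be in the kernel of the Auslander map.
\<close>

lemma tr_ideal_fixed_nonzero: obtains s where "s \<in> tr_ideal" "s \<in> fixed" "s \<noteq> 0"
proof -
  obtain d where d: "d \<in> tr_ideal" "d \<noteq> 0" by (rule tr_ideal_nonzero)
  have "\<exists>c\<in>B. trace (d * c) \<noteq> 0"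
  proof (rule ccontr)
    assume "\<not> ?thesis"
    then have "aus (\<lambda>g. act g d) c = 0" if "c \<in> B" for c
      using that d(1) by (simp add: aus_def trace_def act_mult tr_ideal_subset)
    then have "act \<one> d = 0"
      by (rule aus_injective [rotated]) (use d in \<open>auto simp: act_B tr_ideal_subset\<close>)
    then show False using d by (simp add: act_id tr_ideal_subset)
  qed
  then obtain c where c: "c \<in> B" "trace (d * c) \<noteq> 0" by blast
  have dc: "d * c \<in> tr_ideal" using d c by (simp add: tr_ideal_mult_right)
  have zero: "0 \<in> tr_ideal" using tr_ideal_mult_left [OF d(1) zero_B] by simp
  have "(\<Sum>g\<in>A. act g (d * c)) \<in> tr_ideal" if "A \<subseteq> carrier \<G>" for A
    using that by (induction A rule: infinite_finite_induct)
      (auto simp: zero intro!: tr_ideal_add tr_ideal_act dc)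
  then have "trace (d * c) \<in> tr_ideal" by (simp add: trace_def)
  then show thesis using that c dc by (meson tr_ideal_subset trace_fixed)
qed

lemma sum_tens_aus:
  assumes "set xs \<subseteq> B \<times> B" "b \<in> B"
  shows "aus (tens xs) b = (\<Sum>(u, v)\<leftarrow>xs. u * trace (v * b))"
  using assms(1)
proof (induction xs)
  case (Cons x xs)
  obtain u v where x: "x = (u, v)" by (cases x)
  have "aus (tens (x # xs)) b = (\<Sum>g\<in>carrier \<G>. u * act g (v * b)) + aus (tens xs) b"
    using Cons.prems assms(2)
    by (simp add: x aus_def distrib_right sum.distrib act_mult mult.assoc)
  then show ?case using Cons by (simp add: x trace_def sum_distrib_left del: tens_simps)
qed (simp add: aus_def)

text \<open>
  The assumption on homomorphisms says that each homomorphism of right \<open>B\<close>-modules from a nonzero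
  two-sided ideal to \<open>B\<close> is left multiplication by an element of \<open>B\<close>. For \<open>d\<close> in the ideal above,
  say \<open>d # 1 = \<Sum> u\<^sub>i E v\<^sub>i\<close>, one has \<open>d b = \<Sum> u\<^sub>i tr(v\<^sub>i b)\<close> and hence \<open>f(d b) = \<Sum> f(u\<^sub>i) tr(v\<^sub>i b)\<close>. So
  \<open>f\<close> composed with multiplication by \<open>d\<close> comes from the skew group ring; its coefficients are called
  \<open>r d\<close>. They depend on \<open>d\<close> in such a way that the assumption applies to \<open>g\<^sup>-\<^sup>1(r d g)\<close>.
\<close>

theorem aus_surjective:
  assumes hom_ext: "\<And>J \<phi>. J \<subseteq> B \<Longrightarrow> \<exists>d\<in>J. d \<noteq> 0 \<Longrightarrow> (\<And>d e. d \<in> J \<Longrightarrow> e \<in> J \<Longrightarrow> d + e \<in> J) \<Longrightarrow>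
      (\<And>d b. d \<in> J \<Longrightarrow> b \<in> B \<Longrightarrow> b * d \<in> J \<and> d * b \<in> J) \<Longrightarrow>
      (\<And>d. d \<in> J \<Longrightarrow> \<phi> d \<in> B) \<Longrightarrow> (\<And>d b. d \<in> J \<Longrightarrow> b \<in> B \<Longrightarrow> \<phi> (d * b) = \<phi> d * b) \<Longrightarrow>
      \<exists>q\<in>B. \<forall>d\<in>J. \<phi> d = q * d"
    and f_B: "\<And>b. b \<in> B \<Longrightarrow> f b \<in> B"
    and f_add: "\<And>b c. b \<in> B \<Longrightarrow> c \<in> B \<Longrightarrow> f (b + c) = f b + f c"
    and f_fixed: "\<And>b s. b \<in> B \<Longrightarrow> s \<in> fixed \<Longrightarrow> f (b * s) = f b * s"
  obtains \<rho> where "\<And>g. g \<in> carrier \<G> \<Longrightarrow> \<rho> g \<in> B" "\<And>b. b \<in> B \<Longrightarrow> f b = aus \<rho> b"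
proof -
  have f_0: "f 0 = 0" using f_add [OF zero_B zero_B] by simp
  have "\<exists>r. (\<forall>g\<in>carrier \<G>. r g \<in> B) \<and> (\<forall>b\<in>B. f (d * b) = aus r b)" if d: "d \<in> tr_ideal" for d
  proof -
    obtain xs where xs: "set xs \<subseteq> B \<times> B"
      and d_eq: "\<And>g. g \<in> carrier \<G> \<Longrightarrow> tens xs g = (if g = \<one> then d else 0)"
      using d by (auto simp: tr_ideal_def)
    define ys where "ys = map (\<lambda>(u, v). (f u, v)) xs"
    have ys: "set ys \<subseteq> B \<times> B" using xs f_B by (auto simp: ys_def)
    have "f (d * b) = aus (tens ys) b" if b: "b \<in> B" for b
    proof -
      have *: "(\<Sum>(u, v)\<leftarrow>xs. u * trace (v * b)) \<in> B \<and>
          f (\<Sum>(u, v)\<leftarrow>xs. u * trace (v * b)) = (\<Sum>(u, v)\<leftarrow>ys. u * trace (v * b))"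
        using xs unfolding ys_def
      proof (induction xs)
        case (Cons x xs)
        obtain u v where x: "x = (u, v)" by (cases x)
        have uv: "u \<in> B" "v \<in> B" using Cons.prems by (auto simp: x)
        then have "trace (v * b) \<in> fixed" "trace (v * b) \<in> B"
          using trace_fixed [of "v * b"] b by (auto simp: mult_B fixed_def)
        then show ?case using Cons uv by (simp add: x f_add f_fixed mult_B add_B)
      qed (simp add: f_0 zero_B)
      have "aus (tens xs) b = (\<Sum>g\<in>carrier \<G>. if g = \<one> then d * b else 0)"
        unfolding aus_def using d_eq b by (intro sum.cong) (auto simp: act_id)
      then have "aus (tens xs) b = d * b" using fin by simp
      then show ?thesis using * by (simp add: sum_tens_aus xs ys b)
    qed
    then show ?thesis using ys by (metis tens_B)
  qed
  then obtain r where r_B: "\<And>d g. d \<in> tr_ideal \<Longrightarrow> g \<in> carrier \<G> \<Longrightarrow> r d g \<in> B"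
    and r: "\<And>d b. d \<in> tr_ideal \<Longrightarrow> b \<in> B \<Longrightarrow> f (d * b) = aus (r d) b"
    by metis
  have r_mult: "r (d * c) g = r d g * act g c"
    if d: "d \<in> tr_ideal" and c: "c \<in> B" and g: "g \<in> carrier \<G>" for d c g
  proof (rule aus_inj_on [where f = "r (d * c)" and f' = "\<lambda>g. r d g * act g c", OF _ _ _ g])
    show "aus (r (d * c)) b = aus (\<lambda>g. r d g * act g c) b" if b: "b \<in> B" for b
    proof -
      have "aus (r (d * c)) b = f (d * c * b)"
        using d c b by (simp add: r tr_ideal_mult_right)
      also have "\<dots> = aus (r d) (c * b)" using d c b by (simp add: r mult_B mult.assoc)
      also have "\<dots> = aus (\<lambda>g. r d g * act g c) b"
        unfolding aus_def using c b by (intro sum.cong) (auto simp: act_mult mult.assoc)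
      finally show ?thesis .
    qed
  qed (use d c in \<open>auto simp: r_B tr_ideal_mult_right mult_B act_B\<close>)
  have "\<exists>q\<in>B. \<forall>d\<in>tr_ideal. act (inv g) (r d g) = q * d" if g: "g \<in> carrier \<G>" for g
  proof (rule hom_ext)
    show "\<exists>d\<in>tr_ideal. d \<noteq> 0" using tr_ideal_nonzero by blast
    fix d b assume "d \<in> tr_ideal" "b \<in> B"
    then show "act (inv g) (r (d * b) g) = act (inv g) (r d g) * b"
      using g by (simp add: r_mult act_mult r_B act_B act_inv_act)
  qed (use g in \<open>auto simp: tr_ideal_subset tr_ideal_add tr_ideal_mult_left tr_ideal_mult_right r_B act_B\<close>)
  then obtain q where q_B: "\<And>g. g \<in> carrier \<G> \<Longrightarrow> q g \<in> B"
    and q: "\<And>g d. g \<in> carrier \<G> \<Longrightarrow> d \<in> tr_ideal \<Longrightarrow> act (inv g) (r d g) = q g * d"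
    by metis
  define \<rho> where "\<rho> g = act g (q g)" for g
  have \<rho>_B: "\<rho> g \<in> B" if "g \<in> carrier \<G>" for g using that by (simp add: \<rho>_def act_B q_B)
  \<comment> \<open>The multipliers found on the ideal define a preimage of \<open>f\<close>, so far only on the ideal.\<close>
  have on_ideal: "f d = aus \<rho> d" if d: "d \<in> tr_ideal" for d
  proof -
    have "r d g = \<rho> g * act g d" if g: "g \<in> carrier \<G>" for g
    proof -
      have "r d g = act g (act (inv g) (r d g))" using g d by (simp add: act_act_inv r_B)
      also have "\<dots> = \<rho> g * act g d" using g d by (simp add: q \<rho>_def act_mult q_B tr_ideal_subset)
      finally show ?thesis .
    qed
    then have "aus (r d) 1 = aus \<rho> d" by (simp add: aus_def act_1)
    then show ?thesis using r [OF d one_B] by simp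
  qed
  obtain s where s: "s \<in> tr_ideal" "s \<in> fixed" "s \<noteq> 0" by (rule tr_ideal_fixed_nonzero)
  \<comment> \<open>Both sides are linear over the fixed ring and \<open>b s\<close> is in the ideal, so \<open>s\<close> can be cancelled.\<close>
  have "f b = aus \<rho> b" if b: "b \<in> B" for b
  proof -
    have "aus \<rho> (b * s) = aus \<rho> b * s"
      unfolding aus_def using s b by (auto simp: act_mult fixed_def sum_distrib_right mult.assoc)
    moreover have "f (b * s) = f b * s" using b s by (simp add: f_fixed)
    moreover have "f (b * s) = aus \<rho> (b * s)" using on_ideal s b by (simp add: tr_ideal_mult_left)
    ultimately show ?thesis using s by simp
  qed
  then show thesis using that \<rho>_B by blast
qed

end

section \<open>The generalized Weyl algebra inside the skew Laurent ring\<close>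

text \<open>
  The polynomial \<open>Y\<^sub>k\<close> for which \<open>Y\<^sub>k x\<^sup>k\<close> is the element of degree \<open>k\<close> in a basis over \<open>k[z]\<close>: it is \<open>1\<close> for
  \<open>k \<ge> 0\<close>, and \<open>(a x\<^sup>-\<^sup>1)\<^sup>m = Y\<^sub>-\<^sub>m x\<^sup>-\<^sup>m\<close>, which corresponds to \<open>y\<^sup>m\<close>.
\<close>

definition ypol :: "'k::field_char_0 poly \<Rightarrow> int \<Rightarrow> 'k poly" where
  "ypol a k = (\<Prod>i<nat (- k). zshift (- int i) a)"

lemma ypol_nonneg [simp]: "0 \<le> k \<Longrightarrow> ypol a k = 1"
  by (simp add: ypol_def)

lemma ypol_add_nonpos:
  assumes "k \<le> 0" "l \<le> 0"
  shows "ypol a (k + l) = ypol a k * zshift k (ypol a l)"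
proof -
  have *: "(\<Prod>t<i + j. zshift (- int t) a) =
      (\<Prod>t<i. zshift (- int t) a) * zshift (- int i) (\<Prod>t<j. zshift (- int t) a)" for i j
    by (induction j) (simp_all add: zshift_mult mult.assoc)
  have "nat (- (k + l)) = nat (- k) + nat (- l)" using assms by simp
  then show ?thesis using * [of "nat (- k)" "nat (- l)"] assms by (simp add: ypol_def)
qed

text \<open>
  The product of the basis elements of degrees \<open>k\<close> and \<open>l\<close> is a multiple of that of degree \<open>k + l\<close>.
\<close>

lemma ypol_dvd: "ypol a (k + l) dvd ypol a k * zshift k (ypol a l)"
proof (cases "k \<le> 0 \<and> l \<le> 0 \<or> 0 \<le> k + l")
  case True
  then show ?thesis by (auto simp: ypol_add_nonpos)
next
  case False
  then consider "0 \<le> k" "l \<le> 0" "k + l \<le> 0" | "k \<le> 0" "0 \<le> l" "k + l \<le> 0" by linarith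
  then show ?thesis
  proof cases
    case 1
    have "ypol a l = ypol a (- k) * zshift (- k) (ypol a (k + l))"
      using ypol_add_nonpos [of "- k" "k + l" a] 1 by simp
    then have "zshift k (ypol a l) = zshift k (ypol a (- k)) * ypol a (k + l)"
      by (simp add: zshift_mult)
    then show ?thesis using 1 by simp
  next
    case 2
    have "ypol a k = ypol a (k + l) * zshift (k + l) (ypol a (- l))"
      using ypol_add_nonpos [of "k + l" "- l" a] 2 by simp
    then show ?thesis by simp
  qed
qed

lemma ypol_nonzero: "a \<noteq> 0 \<Longrightarrow> ypol a k \<noteq> 0"
  by (simp add: ypol_def)

lemma degree_ypol: "a \<noteq> 0 \<Longrightarrow> degree (ypol a k) = nat (- k) * degree a"
  by (simp add: ypol_def degree_prod_eq_sum_degree)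

lemma ypol_minus_one [simp]: "ypol a (- 1) = a"
  by (simp add: ypol_def)

text \<open>
  The image of the generalized Weyl algebra, described by divisibility of coefficients.
\<close>

definition gwa_sub :: "'k::field_char_0 poly \<Rightarrow> 'k skew_laurent set" where
  "gwa_sub a = {s. \<forall>k. ypol a k dvd scoeff s k}"

lemma zshift_dvd_zshift: "p dvd q \<Longrightarrow> zshift k p dvd zshift k q"
  by (auto simp: dvd_def zshift_mult)

lemma gwa_sub_0: "0 \<in> gwa_sub a"
  and gwa_sub_diff: "s \<in> gwa_sub a \<Longrightarrow> t \<in> gwa_sub a \<Longrightarrow> s - t \<in> gwa_sub a"
  and gwa_sub_add: "s \<in> gwa_sub a \<Longrightarrow> t \<in> gwa_sub a \<Longrightarrow> s + t \<in> gwa_sub a"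
  by (auto simp: gwa_sub_def)

lemma gwa_sub_mult:
  assumes "s \<in> gwa_sub a" "t \<in> gwa_sub a"
  shows "s * t \<in> gwa_sub a"
  unfolding gwa_sub_def mem_Collect_eq
proof
  fix m
  have "ypol a m dvd scoeff s k * zshift k (scoeff t (m - k))" for k
  proof -
    have "ypol a (k + (m - k)) dvd ypol a k * zshift k (ypol a (m - k))" by (rule ypol_dvd)
    also have "\<dots> dvd scoeff s k * zshift k (scoeff t (m - k))"
      using assms by (intro mult_dvd_mono zshift_dvd_zshift) (auto simp: gwa_sub_def)
    finally show ?thesis by simp
  qed
  then show "ypol a m dvd scoeff (s * t) m"
    by (simp add: scoeff_mult [OF finite_supp order_refl] dvd_sum)
qed

lemma smono_in_gwa_sub_iff: "smono p k \<in> gwa_sub a \<longleftrightarrow> ypol a k dvd p"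
  by (auto simp: gwa_sub_def scoeff_smono)

lemma gwa_sub_1: "1 \<in> gwa_sub a"
  using smono_in_gwa_sub_iff [of 1 0 a] by (simp add: smono_1_0)

lemma sdeg_nonneg:
  assumes "a \<noteq> 0" "s \<in> gwa_sub a" "s \<noteq> 0"
  shows "0 \<le> sdeg (degree a) s"
proof -
  obtain k where k: "k \<in> supp s" "wt (degree a) s k = sdeg (degree a) s"
    using sdeg_attained [OF assms(3)] by metis
  have "0 \<le> wt (degree a) s k"
  proof (cases "0 \<le> k")
    case False
    have "degree (ypol a k) \<le> degree (scoeff s k)"
      using assms(2) k by (intro dvd_imp_degree_le) (auto simp: gwa_sub_def in_supp_iff)
    then have "int (nat (- k) * degree a) \<le> int (degree (scoeff s k))"
      by (simp only: degree_ypol [OF assms(1)] of_nat_le_iff)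
    moreover have "int (nat (- k) * degree a) = - k * int (degree a)" using False by simp
    ultimately show ?thesis by (simp add: wt_def algebra_simps)
  qed (simp add: wt_def)
  then show ?thesis using k by simp
qed

section \<open>Homomorphisms out of a nonzero ideal\<close>

text \<open>
  Commutation with \<open>z\<close> multiplies the term \<open>p x\<^sup>k\<close> by \<open>k\<close>. In characteristic zero it therefore separates
  the terms, and an element of minimal support in the ideal is a single term \<open>p x\<^sup>i\<close>; multiplying
  by the basis element of degree \<open>- i\<close> leads to degree \<open>0\<close>.
\<close>

lemma ideal_contains_polynomial:
  fixes J :: "'k::field_char_0 skew_laurent set"
  assumes "J \<subseteq> gwa_sub a" and "a \<noteq> 0" and nz: "\<exists>d\<in>J. d \<noteq> 0"
    and add: "\<And>d e. d \<in> J \<Longrightarrow> e \<in> J \<Longrightarrow> d + e \<in> J"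
    and ideal: "\<And>d b. d \<in> J \<Longrightarrow> b \<in> gwa_sub a \<Longrightarrow> b * d \<in> J \<and> d * b \<in> J"
  obtains P where "P \<noteq> 0" "smono P 0 \<in> J"
proof -
  have diff: "d - e \<in> J" if "d \<in> J" "e \<in> J" for d e
  proof -
    have "- 1 \<in> gwa_sub a" using gwa_sub_diff [OF gwa_sub_0 gwa_sub_1] by simp
    then have "- 1 * e \<in> J" using ideal that by blast
    then show ?thesis using add [of d "- 1 * e"] that by simp
  qed
  obtain j where j: "j \<in> J \<and> j \<noteq> 0"
    and min: "\<And>t. t \<in> J \<and> t \<noteq> 0 \<Longrightarrow> card (supp j) \<le> card (supp t)"
    using nz ex_has_least_nat [of "\<lambda>j. j \<in> J \<and> j \<noteq> 0" _ "\<lambda>j. card (supp j)"] by blast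
  then obtain i where i: "i \<in> supp j" using supp_eq_empty_iff by blast
  have "scoeff j k = 0" if "k \<noteq> i" for k
  proof (rule ccontr)
    assume k: "scoeff j k \<noteq> 0"
    define z where "z = smono [:0, 1::'k:] 0"
    define t where "t = z * j - j * z - smono [:of_int i:] 0 * j"
    have T: "z \<in> gwa_sub a" "smono [:of_int i:] 0 \<in> gwa_sub a"
      by (simp_all add: z_def smono_in_gwa_sub_iff)
    then have "z * j \<in> J" "j * z \<in> J" "smono [:of_int i:] 0 * j \<in> J" using j ideal by auto
    then have "t \<in> J" unfolding t_def by (intro diff)
    have t: "scoeff t l = [:of_int (l - i):] * scoeff j l" for l
    proof -
      have "zshift l [:0, 1::'k:] = [:0, 1:] - [:of_int l:]"
        by (simp add: zshift_def pcompose_pCons)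
      moreover have "[:of_int (l - i):] = [:of_int l:] - [:of_int i :: 'k:]" by simp
      moreover have "Z * s - s * (Z - L) - I * s = (L - I) * s" for Z L I s :: "'k poly"
        by (simp add: algebra_simps)
      ultimately show ?thesis
        by (simp only: t_def z_def scoeff_diff scoeff_smono_mult scoeff_mult_smono diff_0_right
            zshift_zero)
    qed
    then have "scoeff t k \<noteq> 0" using k that by simp
    then have "t \<noteq> 0" by auto
    have "scoeff t i = 0" using t by simp
    then have "supp t \<subset> supp j" using i t by (auto simp: in_supp_iff)
    then have "card (supp t) < card (supp j)" by (simp add: psubset_card_mono)
    then show False using min [of t] \<open>t \<in> J\<close> \<open>t \<noteq> 0\<close> by simp
  qed
  then have j_eq: "j = smono (scoeff j i) i" by (intro skew_eqI) (simp add: scoeff_smono)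
  define e where "e = smono (ypol a (- i)) (- i)"
  have "e \<in> gwa_sub a" by (simp add: e_def smono_in_gwa_sub_iff)
  then have "j * e \<in> J" using j ideal by blast
  moreover have "j * e = smono (scoeff j i * zshift i (ypol a (- i))) 0"
    by (subst j_eq) (simp add: e_def smono_mult_smono)
  moreover have "scoeff j i * zshift i (ypol a (- i)) \<noteq> 0"
    using i ypol_nonzero [OF \<open>a \<noteq> 0\<close>] by (simp add: in_supp_iff)
  ultimately show thesis using that by metis
qed

text \<open>
  If \<open>P\<close> is in the ideal and \<open>e\<close> is \<open>x\<^sup>m\<close> or \<open>y\<^sup>m\<close>, then so are \<open>P e\<close> and \<open>e P = \<sigma>\<^sup>k(P) e\<close>, where
  \<open>k\<close> is \<open>m\<close> or \<open>- m\<close>. In characteristic zero, \<open>m\<close> can be chosen different from all differences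
  of two roots of \<open>P\<close>; then \<open>P\<close> and \<open>\<sigma>\<^sup>k(P)\<close> have no common root and a Bezout identity gives \<open>e\<close>.
\<close>

lemma ideal_contains_powers:
  fixes J :: "'k::{alg_closed_field, field_char_0} skew_laurent set"
  assumes J: "J \<subseteq> gwa_sub a" and "a \<noteq> 0" and nz: "\<exists>d\<in>J. d \<noteq> 0"
    and add: "\<And>d e. d \<in> J \<Longrightarrow> e \<in> J \<Longrightarrow> d + e \<in> J"
    and ideal: "\<And>d b. d \<in> J \<Longrightarrow> b \<in> gwa_sub a \<Longrightarrow> b * d \<in> J \<and> d * b \<in> J"
  obtains m :: nat where "smono 1 (int m) \<in> J" "smono (ypol a (- int m)) (- int m) \<in> J"
proof -
  obtain P where P: "P \<noteq> 0" "smono P 0 \<in> J"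
    by (rule ideal_contains_polynomial [OF J \<open>a \<noteq> 0\<close> nz add ideal])
  define D where "D = (\<lambda>(c, d). d - c) ` ({c. poly P c = 0} \<times> {c. poly P c = 0})"
  have "finite D" using P(1) by (simp add: D_def poly_roots_finite)
  then have "finite ((of_nat :: nat \<Rightarrow> 'k) -` D)" by (intro finite_vimageI) (auto simp: inj_on_def)
  then obtain m :: nat where m: "of_nat m \<notin> D"
    using infinite_UNIV_nat by (metis UNIV_eq_I vimage_eq)
  have "smono (ypol a k) k \<in> J" if k: "k = int m \<or> k = - int m" for k
  proof -
    have "\<exists>u v. u * P + v * zshift k P = 1"
    proof (rule bezout_if_no_common_root [OF P(1)])
      fix c assume c: "poly P c = 0"
      show "poly (zshift k P) c \<noteq> 0"
      proof
        assume "poly (zshift k P) c = 0"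
        then have "poly P (c - of_int k) = 0" by (simp add: poly_zshift)
        then have "of_int k \<in> D" "- of_int k \<in> D" using c
          by (force simp: D_def intro!: image_eqI [where x = "(c - of_int k, c)"])
            (use \<open>poly P (c - of_int k) = 0\<close> c in
              \<open>force simp: D_def intro!: image_eqI [where x = "(c, c - of_int k)"]\<close>)
        then show False using k m by auto
      qed
    qed
    then obtain u v where uv: "u * P + v * zshift k P = 1" by blast
    define e where "e = smono (ypol a k) k"
    have T: "smono u 0 \<in> gwa_sub a" "smono v 0 \<in> gwa_sub a" "e \<in> gwa_sub a"
      by (simp_all add: e_def smono_in_gwa_sub_iff)
    have "smono u 0 * (smono P 0 * e) + smono v 0 * (e * smono P 0) =
        smono ((u * P + v * zshift k P) * ypol a k) k"
      by (simp add: e_def smono_mult_smono smono_add [symmetric] algebra_simps)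
    also have "\<dots> = e" by (simp add: uv e_def)
    finally show ?thesis using T P(2) ideal add unfolding e_def [symmetric] by metis
  qed
  from this [of "int m"] this [of "- int m"] show thesis using that by auto
qed

text \<open>
  As \<open>x\<close> is invertible in the Laurent ring, the only possible multiplier is \<open>q = \<phi>(x\<^sup>m) x\<^sup>-\<^sup>m\<close>. For any
  \<open>d\<close> in the ideal, \<open>d x\<^sup>N\<close> is in \<open>x\<^sup>m R\<close> if \<open>N\<close> is large, and this implies \<open>\<phi>(d) = q d\<close>. Finally
  \<open>q y\<^sup>m = \<phi>(y\<^sup>m)\<close> is in \<open>R\<close>, and removing \<open>y\<^sup>m\<close> from its coefficients of negative degree shows
  \<open>q \<in> R\<close>.
\<close>

lemma hom_from_ideal_extends:
  fixes J :: "'k::{alg_closed_field, field_char_0} skew_laurent set"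
  assumes J: "J \<subseteq> gwa_sub a" and "a \<noteq> 0" and nz: "\<exists>d\<in>J. d \<noteq> 0"
    and add: "\<And>d e. d \<in> J \<Longrightarrow> e \<in> J \<Longrightarrow> d + e \<in> J"
    and ideal: "\<And>d b. d \<in> J \<Longrightarrow> b \<in> gwa_sub a \<Longrightarrow> b * d \<in> J \<and> d * b \<in> J"
    and \<phi>_T: "\<And>d. d \<in> J \<Longrightarrow> \<phi> d \<in> gwa_sub a"
    and \<phi>: "\<And>d b. d \<in> J \<Longrightarrow> b \<in> gwa_sub a \<Longrightarrow> \<phi> (d * b) = \<phi> d * b"
  shows "\<exists>q\<in>gwa_sub a. \<forall>d\<in>J. \<phi> d = q * d"
proof -
  obtain m where x: "smono 1 (int m) \<in> J" and y: "smono (ypol a (- int m)) (- int m) \<in> J"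
    by (rule ideal_contains_powers [OF J \<open>a \<noteq> 0\<close> nz add ideal])
  define q where "q = \<phi> (smono 1 (int m)) * smono 1 (- int m)"
  have q_eq: "\<phi> d = q * d" if d: "d \<in> J" for d
  proof -
    \<comment> \<open>Any bound on the absolute values of the exponents in \<open>d\<close> would do.\<close>
    define M where "M = (\<Sum>k\<in>supp d. \<bar>k\<bar>)"
    have M: "\<bar>k\<bar> \<le> M" if "k \<in> supp d" for k
      unfolding M_def using that by (intro member_le_sum) auto
    have "0 \<le> M" by (simp add: M_def sum_nonneg)
    define N where "N = int m + M"
    define t where "t = smono 1 (- int m) * d * smono 1 N"
    have t: "scoeff t k = zshift (- int m) (scoeff d (k - M))" for k
      by (simp add: t_def N_def scoeff_mult_smono scoeff_smono_mult algebra_simps)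
    have "ypol a k dvd scoeff t k" for k
    proof (cases "0 \<le> k")
      case False
      then have "k - M \<notin> supp d" using M [of "k - M"] by auto
      then show ?thesis by (simp add: t in_supp_iff)
    qed simp
    then have "t \<in> gwa_sub a" by (simp add: gwa_sub_def)
    moreover have "smono 1 N \<in> gwa_sub a" using \<open>0 \<le> M\<close> by (simp add: smono_in_gwa_sub_iff N_def)
    moreover have xt: "smono 1 (int m) * t = d * smono 1 N"
      by (simp add: t_def mult.assoc [symmetric] smono_mult_smono smono_1_0)
    ultimately have "\<phi> d * smono 1 N = \<phi> (smono 1 (int m)) * t"
      using \<phi> [OF d, of "smono 1 N"] \<phi> [OF x, of t] by simp
    also have "\<dots> = q * (smono 1 (int m) * t)"
      by (simp add: q_def mult.assoc) (simp add: mult.assoc [symmetric] smono_mult_smono smono_1_0)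
    also have "\<dots> = q * d * smono 1 N" by (simp add: xt mult.assoc)
    finally show ?thesis by simp
  qed
  have "q \<in> gwa_sub a"
    unfolding gwa_sub_def mem_Collect_eq
  proof
    fix k
    show "ypol a k dvd scoeff q k"
    proof (cases "0 \<le> k")
      case False
      have "q * smono (ypol a (- int m)) (- int m) \<in> gwa_sub a"
        using q_eq [OF y] \<phi>_T [OF y] by simp
      then have "ypol a (k + (- int m)) dvd
          scoeff (q * smono (ypol a (- int m)) (- int m)) (k + (- int m))"
        unfolding gwa_sub_def by blast
      then have "ypol a k * zshift k (ypol a (- int m)) dvd scoeff q k * zshift k (ypol a (- int m))"
        using False ypol_add_nonpos [of k "- int m" a] by (simp add: scoeff_mult_smono)
      then show ?thesis using ypol_nonzero [OF \<open>a \<noteq> 0\<close>] by simp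
    qed simp
  qed
  then show ?thesis using q_eq by blast
qed

section \<open>Filtered automorphisms of finite order are outer\<close>

text \<open>
  Modulo lower degree everything commutes, so \<open>r g(d) = d r\<close> and \<open>r g(b) g(d) = d b r\<close> imply that
  \<open>g(b) - b\<close> has smaller degree than \<open>b\<close>. If \<open>b\<close> has minimal degree among the elements that \<open>g\<close>
  moves, then \<open>g\<close> fixes \<open>c = g(b) - b\<close>, so \<open>g\<^sup>N(b) = b + N c\<close>, and \<open>N c = 0\<close> forces \<open>c = 0\<close>.
\<close>

lemma filtered_finite_order_outer:
  fixes a :: "'k::field_char_0 poly"
  assumes "a \<noteq> 0"
    and g_T: "\<And>b. b \<in> gwa_sub a \<Longrightarrow> g b \<in> gwa_sub a"
    and g_add: "\<And>b c. b \<in> gwa_sub a \<Longrightarrow> c \<in> gwa_sub a \<Longrightarrow> g (b + c) = g b + g c"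
    and g_1: "g 1 = 1"
    and g_deg: "\<And>b. b \<in> gwa_sub a \<Longrightarrow> b \<noteq> 0 \<Longrightarrow> g b \<noteq> 0 \<and> sdeg (degree a) (g b) = sdeg (degree a) b"
    and order: "N > 0" "\<And>b. b \<in> gwa_sub a \<Longrightarrow> (g ^^ N) b = b"
    and r: "r \<in> gwa_sub a" "r \<noteq> 0" and d: "d \<in> gwa_sub a" "d \<noteq> 0"
    and inner: "\<And>b. b \<in> gwa_sub a \<Longrightarrow> r * g b * g d = d * b * r"
    and b: "b \<in> gwa_sub a"
  shows "g b = b"
proof -
  define n where "n = degree a"
  have rd: "r * g d = d * r" using inner [OF gwa_sub_1] by (simp add: g_1)
  have gd: "g d \<noteq> 0" "sdeg n (g d) = sdeg n d" using g_deg [OF d] by (auto simp: n_def)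
  have low: "sdeg n (g b - b) < sdeg n b" if b: "b \<in> gwa_sub a" "g b \<noteq> b" for b
  proof -
    have "b \<noteq> 0" using b g_add [OF gwa_sub_0 gwa_sub_0] by auto
    have "r * (g b - b) * g d = d * b * r - r * b * g d"
      using inner [OF b(1)] by (simp add: algebra_simps)
    also have "\<dots> = (d * b - b * d) * r + (b * r - r * b) * g d"
      using rd by (simp add: left_diff_distrib mult.assoc)
    also have "deg_below n (sdeg n d + sdeg n b + sdeg n r) \<dots>"
    proof (rule deg_below_add)
      show "deg_below n (sdeg n d + sdeg n b + sdeg n r) ((d * b - b * d) * r)"
        using d r \<open>b \<noteq> 0\<close> by (intro deg_below_mult_right deg_below_commutator)
      have "deg_below n (sdeg n b + sdeg n r + sdeg n (g d)) ((b * r - r * b) * g d)"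
        using gd r \<open>b \<noteq> 0\<close> by (intro deg_below_mult_right deg_below_commutator)
      then show "deg_below n (sdeg n d + sdeg n b + sdeg n r) ((b * r - r * b) * g d)"
        by (simp add: gd algebra_simps)
    qed
    finally have "deg_below n (sdeg n d + sdeg n b + sdeg n r) (r * (g b - b) * g d)" .
    moreover have "g b - b \<noteq> 0" using b by simp
    ultimately show ?thesis using gd r by (simp add: deg_below_iff sdeg_mult)
  qed
  show "g b = b"
    using b
  proof (induction "nat (sdeg n b)" arbitrary: b rule: less_induct)
    case less
    show "g b = b"
    proof (rule ccontr)
      assume ne: "g b \<noteq> b"
      define c where "c = g b - b"
      have c: "c \<in> gwa_sub a" "c \<noteq> 0" using ne less.prems by (auto simp: c_def gwa_sub_diff g_T)
      have "nat (sdeg n c) < nat (sdeg n b)"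
        using low [OF less.prems ne] sdeg_nonneg [OF \<open>a \<noteq> 0\<close> c] by (simp add: n_def c_def)
      then have gc: "g c = c" using less.hyps c by blast
      have mult_T: "of_nat i * c \<in> gwa_sub a" for i
        by (induction i) (auto simp: gwa_sub_0 gwa_sub_add c distrib_right)
      have g_mult: "g (of_nat i * c) = of_nat i * c" for i
        using g_add [OF gwa_sub_0 gwa_sub_0]
        by (induction i) (auto simp: distrib_right g_add c mult_T gc)
      have "(g ^^ i) b = b + of_nat i * c" for i
      proof (induction i)
        case (Suc i)
        have gb: "g b = b + c" by (simp add: c_def)
        have "(g ^^ Suc i) b = g b + g (of_nat i * c)" using Suc less.prems by (simp add: g_add mult_T)
        then show ?case by (simp add: g_mult gb distrib_right)
      qed simp
      then have "of_nat N * c = 0" using order(2) [OF less.prems] by (metis add_cancel_right_right)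
      moreover have "(of_nat N :: 'k skew_laurent) \<noteq> 0"
      proof -
        have "of_nat i = smono [:of_nat i :: 'k:] 0" for i
          by (induction i) (simp_all add: smono_1_0 [symmetric] smono_add [symmetric] one_pCons)
        then show ?thesis using order(1) by simp
      qed
      ultimately show False using c by simp
    qed
  qed
qed

section \<open>Evaluating the free algebra in the skew Laurent ring\<close>

fun ev_gen :: "'k::field_char_0 poly \<Rightarrow> gen \<Rightarrow> 'k skew_laurent" where
  "ev_gen a GX = smono 1 1"
| "ev_gen a GY = smono a (- 1)"
| "ev_gen a GZ = smono [:0, 1:] 0"

definition ev_word :: "'k::field_char_0 poly \<Rightarrow> word \<Rightarrow> 'k skew_laurent" where
  "ev_word a w = prod_list (map (ev_gen a) (letters w))"

definition ev :: "'k::field_char_0 poly \<Rightarrow> 'k free_alg \<Rightarrow> 'k skew_laurent" where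
  "ev a p = (\<Sum>w\<in>Poly_Mapping.keys p. smono [:Poly_Mapping.lookup p w:] 0 * ev_word a w)"

lemma ev_word_0 [simp]: "ev_word a 0 = 1"
  and ev_word_add: "ev_word a (v + w) = ev_word a v * ev_word a w"
  and ev_word_singleton [simp]: "ev_word a (Word [g]) = ev_gen a g"
  by (simp_all add: ev_word_def zero_word_def plus_word_def)

lemma ev_superset:
  assumes "finite W" "Poly_Mapping.keys p \<subseteq> W"
  shows "ev a p = (\<Sum>w\<in>W. smono [:Poly_Mapping.lookup p w:] 0 * ev_word a w)"
  unfolding ev_def using assms by (intro sum.mono_neutral_left) (auto simp: in_keys_iff)

lemma ev_0 [simp]: "ev a 0 = 0"
  by (simp add: ev_def)

lemma ev_add: "ev a (p + q) = ev a p + ev a q"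
proof -
  define W where "W = Poly_Mapping.keys p \<union> Poly_Mapping.keys q"
  have "finite W" "Poly_Mapping.keys (p + q) \<subseteq> W" "Poly_Mapping.keys p \<subseteq> W" "Poly_Mapping.keys q \<subseteq> W"
    using Poly_Mapping.keys_add [of p q] by (auto simp: W_def)
  moreover have "smono [:b + c:] 0 = smono [:b:] 0 + smono [:c:] 0" for b c :: 'a
    by (simp add: smono_add [symmetric])
  ultimately show ?thesis
    by (simp add: ev_superset [of W] lookup_add distrib_right sum.distrib)
qed

lemma ev_uminus: "ev a (- p) = - ev a p"
  using ev_add [of a p "- p"] by (simp add: eq_neg_iff_add_eq_0 add.commute)

lemma ev_diff: "ev a (p - q) = ev a p - ev a q"
  using ev_add [of a p "- q"] by (simp add: ev_uminus)

lemma ev_single: "ev a (Poly_Mapping.single w c) = smono [:c:] 0 * ev_word a w"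
  using ev_superset [of "{w}" "Poly_Mapping.single w c" a] by simp

lemma smono_const_central: "smono [:c:] 0 * s = s * smono [:c:] 0"
  by (rule skew_eqI) (simp add: scoeff_smono_mult scoeff_mult_smono)

lemma free_alg_induct [case_names single add]:
  fixes p :: "'k::field free_alg"
  assumes "\<And>w c. P (Poly_Mapping.single w c)" and "\<And>p q. P p \<Longrightarrow> P q \<Longrightarrow> P (p + q)"
  shows "P p"
proof (induction p rule: update_induct)
  case const
  then show ?case using assms(1) [of 0 0] by simp
next
  case (update f w c)
  then have "Poly_Mapping.update w c f = Poly_Mapping.single w c + f"
    by (intro poly_mapping_eqI)
      (auto simp: lookup_update lookup_add lookup_single when_def in_keys_iff)
  then show ?case using assms update by metis
qed

lemma ev_mult: "ev a (p * q) = ev a p * ev a q"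
proof (induction p rule: free_alg_induct)
  case (single v b)
  show ?case
  proof (induction q rule: free_alg_induct)
    case (single w c)
    have "ev a (Poly_Mapping.single v b * Poly_Mapping.single w c) =
        smono [:b:] 0 * (smono [:c:] 0 * ev_word a v) * ev_word a w"
      by (simp add: mult_single ev_single ev_word_add mult.assoc [symmetric] smono_mult_smono
          mult.commute [of b c])
    also have "\<dots> = (smono [:b:] 0 * ev_word a v) * (smono [:c:] 0 * ev_word a w)"
      by (simp only: smono_const_central [of c "ev_word a v"] mult.assoc)
    finally show ?case by (simp add: ev_single)
  qed (simp add: ev_add distrib_left)
qed (simp add: ev_add distrib_right)

lemma ev_const [simp]: "ev a (const c) = smono [:c:] 0"
  by (simp add: const_def ev_single)

lemma ev_1 [simp]: "ev a 1 = 1"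
  using ev_const [of a 1] by (simp add: const_def smono_1_0 one_pCons [symmetric])

lemma ev_var [simp]: "ev a (var g) = ev_gen a g"
  by (simp add: var_def ev_single smono_1_0 one_pCons [symmetric])

lemma ev_power: "ev a (p ^ i) = ev a p ^ i"
  by (induction i) (simp_all add: ev_mult)

lemma const_0 [simp]: "const 0 = 0"
  and const_1 [simp]: "const 1 = 1"
  and const_add: "const (b + c) = const b + const c"
  and const_mult: "const (b * c) = const b * const c"
  by (simp_all add: const_def single_add mult_single)

lemma const_central: "const c * p = p * const c"
  by (induction p rule: free_alg_induct) (simp_all add: const_def mult_single distrib_left distrib_right mult.commute)

lemma in_z_upto:
  assumes "degree d \<le> N"
  shows "in_z d = (\<Sum>i\<le>N. const (coeff d i) * var GZ ^ i)"
  unfolding in_z_def using assms by (intro sum.mono_neutral_left) (auto simp: coeff_eq_0)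

lemma in_z_0 [simp]: "in_z 0 = 0"
  by (simp add: in_z_def)

lemma in_z_add: "in_z (p + q) = in_z p + in_z q"
proof -
  define N where "N = max (degree p) (degree q)"
  have "degree (p + q) \<le> N" "degree p \<le> N" "degree q \<le> N"
    by (auto simp: N_def degree_add_le_max)
  then show ?thesis by (simp add: in_z_upto [of _ N] const_add distrib_right sum.distrib)
qed

lemma in_z_smult: "in_z (Polynomial.smult c p) = const c * in_z p"
proof -
  have "in_z (Polynomial.smult c p) = (\<Sum>i\<le>degree p. const (c * coeff p i) * var GZ ^ i)"
    by (subst in_z_upto [of _ "degree p"]) auto
  then show ?thesis by (simp add: in_z_def const_mult sum_distrib_left mult.assoc)
qed

lemma in_z_pCons: "in_z (pCons c p) = const c + var GZ * in_z p"
proof -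
  have "in_z (pCons c p) = (\<Sum>i\<le>Suc (degree p). const (coeff (pCons c p) i) * var GZ ^ i)"
    by (rule in_z_upto) (simp add: degree_pCons_le)
  also have "\<dots> = const c + (\<Sum>i\<le>degree p. const (coeff p i) * (var GZ * var GZ ^ i))"
    by (subst sum.atMost_Suc_shift) simp
  also have "\<dots> = const c + (\<Sum>i\<le>degree p. var GZ * (const (coeff p i) * var GZ ^ i))"
    by (metis (no_types, lifting) const_central mult.assoc)
  finally show ?thesis by (simp add: in_z_def sum_distrib_left)
qed

lemma in_z_mult: "in_z (p * q) = in_z p * in_z q"
  by (induction p) (simp_all add: in_z_pCons in_z_add in_z_smult distrib_right mult.assoc)

lemma ev_in_z [simp]: "ev a (in_z d) = smono d 0"
proof (induction d)
  case (pCons c d)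
  have "smono (pCons c d) 0 = smono ([:c:] + [:0, 1:] * d) 0" by simp
  also have "\<dots> = smono [:c:] 0 + smono [:0, 1:] 0 * smono d 0"
    by (simp only: smono_add smono_mult_smono zshift_zero add_0)
  finally show ?case by (simp add: in_z_pCons ev_add ev_mult pCons)
qed simp

lemma ev_gen_in_gwa_sub: "ev_gen a g \<in> gwa_sub a"
  by (cases g) (auto simp: smono_in_gwa_sub_iff)

lemma ev_word_in_gwa_sub: "ev_word a w \<in> gwa_sub a"
proof -
  have "prod_list (map (ev_gen a) gs) \<in> gwa_sub a" for gs
    by (induction gs) (auto simp: gwa_sub_1 gwa_sub_mult ev_gen_in_gwa_sub)
  then show ?thesis by (simp add: ev_word_def)
qed

lemma ev_in_gwa_sub: "ev a p \<in> gwa_sub a"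
proof (induction p rule: free_alg_induct)
  case (single w c)
  have "smono [:c:] 0 \<in> gwa_sub a" by (simp add: smono_in_gwa_sub_iff)
  then show ?case by (simp add: ev_single gwa_sub_mult ev_word_in_gwa_sub)
qed (simp add: ev_add gwa_sub_add)

section \<open>Normal forms and the kernel of evaluation\<close>

lemma free_alg_simps [simp]:
  "carrier free_alg = UNIV" "p \<otimes>\<^bsub>free_alg\<^esub> q = p * q" "p \<oplus>\<^bsub>free_alg\<^esub> q = p + q"
  "\<one>\<^bsub>free_alg\<^esub> = 1" "\<zero>\<^bsub>free_alg\<^esub> = 0"
  by (simp_all add: free_alg_def)

lemma ring_free_alg: "ring (free_alg :: 'k::field free_alg ring)"
proof (rule ringI)
  show "abelian_group (free_alg :: 'k free_alg ring)"
    by (rule abelian_groupI) (auto simp: add.assoc add.commute intro: exI [of _ "- x" for x] ab_left_minus)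
  show "Group.monoid (free_alg :: 'k free_alg ring)"
    by (rule monoidI) (auto simp: mult.assoc)
qed (auto simp: distrib_left distrib_right)

lemma a_minus_free_alg [simp]: "\<ominus>\<^bsub>free_alg\<^esub> p = - (p :: 'k::field free_alg)"
proof -
  interpret ring "free_alg :: 'k free_alg ring" by (rule ring_free_alg)
  show ?thesis using minus_equality [of "- p" p] by simp
qed

lemma ideal_gwa_ideal: "ideal (gwa_ideal \<sigma> a) free_alg"
  unfolding gwa_ideal_def by (rule ring.genideal_ideal [OF ring_free_alg]) simp

lemma
  fixes \<sigma> :: "'k::field poly \<Rightarrow> 'k poly"
  assumes "p \<in> gwa_ideal \<sigma> a"
  shows gwa_ideal_add: "q \<in> gwa_ideal \<sigma> a \<Longrightarrow> p + q \<in> gwa_ideal \<sigma> a"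
    and gwa_ideal_uminus: "- p \<in> gwa_ideal \<sigma> a"
    and gwa_ideal_mult_left: "q * p \<in> gwa_ideal \<sigma> a"
    and gwa_ideal_mult_right: "p * q \<in> gwa_ideal \<sigma> a"
proof -
  interpret ideal "gwa_ideal \<sigma> a" free_alg by (rule ideal_gwa_ideal)
  show "p + q \<in> gwa_ideal \<sigma> a" if "q \<in> gwa_ideal \<sigma> a"
    using additive_subgroup.a_closed [OF additive_subgroup_axioms assms that] by simp
  show "- p \<in> gwa_ideal \<sigma> a" using additive_subgroup.a_inv_closed [OF additive_subgroup_axioms assms] by simp
  show "q * p \<in> gwa_ideal \<sigma> a" using I_l_closed [OF assms, of q] by simp
  show "p * q \<in> gwa_ideal \<sigma> a" using I_r_closed [OF assms, of q] by simp
qed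

lemma gwa_ideal_0: "0 \<in> gwa_ideal \<sigma> a"
proof -
  interpret ideal "gwa_ideal \<sigma> a" free_alg by (rule ideal_gwa_ideal)
  show ?thesis using additive_subgroup.zero_closed [OF additive_subgroup_axioms] by simp
qed

lemma gwa_ideal_diff: "p \<in> gwa_ideal \<sigma> a \<Longrightarrow> q \<in> gwa_ideal \<sigma> a \<Longrightarrow> p - q \<in> gwa_ideal \<sigma> a"
  using gwa_ideal_add [of p \<sigma> a "- q"] gwa_ideal_uminus [of q \<sigma> a] by simp

lemma gwa_rels_in_ideal: "gwa_rels \<sigma> a \<subseteq> gwa_ideal \<sigma> a"
  unfolding gwa_ideal_def by (rule ring.genideal_self [OF ring_free_alg]) simp

lemma
  fixes a :: "'k::field_char_0 poly"
  shows rel_XY: "var GX * var GY - in_z (zshift 1 a) \<in> gwa_ideal shift a"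
    and rel_YX: "var GY * var GX - in_z a \<in> gwa_ideal shift a"
    and rel_Xd: "var GX * in_z d - in_z (zshift 1 d) * var GX \<in> gwa_ideal shift a"
    and rel_Yd: "var GY * in_z d - in_z (zshift (- 1) d) * var GY \<in> gwa_ideal shift a"
  unfolding zshift_one_eq_shift zshift_minus_one_eq
  by (rule subsetD [OF gwa_rels_in_ideal], auto simp: gwa_rels_def)+

text \<open>
  The basis element of degree \<open>k\<close>, written as a word in the generators: \<open>x\<^sup>k\<close> or \<open>y\<^sup>-\<^sup>k\<close>.
\<close>

definition nf_mono :: "int \<Rightarrow> 'k::field free_alg" where
  "nf_mono k = (if 0 \<le> k then var GX ^ nat k else var GY ^ nat (- k))"

text \<open>
  A preimage of \<open>s\<close> under evaluation, when \<open>s\<close> is in the image. It serves both to determine the kernel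
  of evaluation and to find representatives of small weight.
\<close>

definition nf :: "'k::field_char_0 poly \<Rightarrow> 'k skew_laurent \<Rightarrow> 'k free_alg" where
  "nf a s = (\<Sum>k\<in>supp s. in_z (scoeff s k div ypol a k) * nf_mono k)"

lemma nf_superset:
  assumes "finite K" "supp s \<subseteq> K"
  shows "nf a s = (\<Sum>k\<in>K. in_z (scoeff s k div ypol a k) * nf_mono k)"
  unfolding nf_def using assms by (intro sum.mono_neutral_left) (auto simp: in_supp_iff)

lemma nf_0 [simp]: "nf a 0 = 0"
  using nf_superset [of "{}" 0 a] by (simp add: in_supp_iff subset_iff)

lemma nf_add: "nf a (s + t) = nf a s + nf a t"
proof -
  define K where "K = supp s \<union> supp t"
  have "finite K" "supp (s + t) \<subseteq> K" "supp s \<subseteq> K" "supp t \<subseteq> K" by (auto simp: K_def in_supp_iff)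
  then show ?thesis by (simp add: nf_superset [of K] poly_div_add_left in_z_add distrib_right sum.distrib)
qed

lemma supp_smono_subset: "supp (smono p k) \<subseteq> {k}"
  by (auto simp: in_supp_iff scoeff_smono split: if_splits)

lemma nf_smono: "a \<noteq> 0 \<Longrightarrow> nf a (smono (ypol a k * q) k) = in_z q * nf_mono k"
  by (simp add: nf_superset [OF _ supp_smono_subset] ypol_nonzero)

text \<open>
  The image is spanned by the products of a polynomial with a basis element.
\<close>

lemma gwa_sub_induct [consumes 1, case_names zero smono add]:
  assumes "s \<in> gwa_sub a" and "P 0" and "\<And>q k. P (smono (ypol a k * q) k)"
    and "\<And>s t. s \<in> gwa_sub a \<Longrightarrow> t \<in> gwa_sub a \<Longrightarrow> P s \<Longrightarrow> P t \<Longrightarrow> P (s + t)"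
  shows "P s"
proof -
  have *: "smono (scoeff s k) k \<in> gwa_sub a \<and> P (smono (scoeff s k) k)" for k
  proof -
    have "ypol a k dvd scoeff s k" using assms(1) by (simp add: gwa_sub_def)
    then show ?thesis using assms(3) by (auto simp: smono_in_gwa_sub_iff)
  qed
  have "(\<Sum>k\<in>K. smono (scoeff s k) k) \<in> gwa_sub a \<and> P (\<Sum>k\<in>K. smono (scoeff s k) k)" for K
    using * by (induction K rule: infinite_finite_induct) (auto simp: assms(2,4) gwa_sub_0 gwa_sub_add)
  then show ?thesis using skew_eq_sum_smono [of s] by metis
qed

lemma smono_power: "smono 1 1 ^ i = smono 1 (int i)"
  by (induction i) (simp_all add: smono_1_0 smono_mult_smono add.commute)

lemma ypol_Suc: "k \<le> 0 \<Longrightarrow> ypol a (k - 1) = a * zshift (- 1) (ypol a k)"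
  using ypol_add_nonpos [of "- 1" k a] by (simp add: algebra_simps)

lemma smono_y_power: "smono a (- 1) ^ i = smono (ypol a (- int i)) (- int i)"
proof (induction i)
  case (Suc i)
  have "ypol a (- int i - 1) = a * zshift (- 1) (ypol a (- int i))" by (rule ypol_Suc) simp
  moreover have "- int (Suc i) = - int i - 1" "- 1 + - int i = - int i - 1" by simp_all
  ultimately show ?case by (simp only: power_Suc Suc smono_mult_smono)
qed (simp add: smono_1_0)

lemma ev_nf_mono: "ev a (nf_mono k) = smono (ypol a k) k"
  by (simp add: nf_mono_def ev_power smono_power smono_y_power)

lemma ev_nf:
  assumes "a \<noteq> 0" "s \<in> gwa_sub a"
  shows "ev a (nf a s) = s"
  using assms(2)
proof (induction rule: gwa_sub_induct)
  case (smono q k)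
  then show ?case
    by (subst nf_smono [OF assms(1)]) (simp add: ev_mult ev_nf_mono smono_mult_smono mult.commute)
qed (simp_all add: nf_add ev_add)

text \<open>
  Normal forms are compatible with multiplication by a generator, modulo the defining relations. A
  generator is moved past the polynomial by the commutation rule; if it then meets the other letter, the
  relation for \<open>x y\<close> or \<open>y x\<close> shortens the word.
\<close>

lemma nf_ev_gen_mult:
  fixes a :: "'k::field_char_0 poly"
  assumes a: "a \<noteq> 0" and "s \<in> gwa_sub a"
  shows "nf a (ev_gen a g * s) - var g * nf a s \<in> gwa_ideal shift a"
  using assms(2)
proof (induction rule: gwa_sub_induct)
  case zero
  then show ?case by (simp add: gwa_ideal_0)
next
  case (add s t)
  then show ?case
    using gwa_ideal_add [OF add.IH] by (simp add: distrib_left nf_add algebra_simps)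
next
  case (smono q k)
  note nf_smono = nf_smono [OF a]
  show ?case
  proof (cases g)
    case GZ
    have "ev_gen a g * smono (ypol a k * q) k = smono (ypol a k * pCons 0 q) k"
      by (simp add: GZ smono_mult_smono)
    then show ?thesis by (simp only: nf_smono GZ) (simp add: in_z_pCons mult.assoc gwa_ideal_0)
  next
    case GX
    show ?thesis
    proof (cases "0 \<le> k")
      case True
      then have "ev_gen a g * smono (ypol a k * q) k = smono (ypol a (k + 1) * zshift 1 q) (k + 1)"
        by (simp add: GX smono_mult_smono add.commute)
      moreover have "nf_mono (k + 1) = var GX * (nf_mono k :: 'k free_alg)"
        using True by (simp add: nf_mono_def nat_add_distrib)
      ultimately have "nf a (ev_gen a g * smono (ypol a k * q) k) - var g * nf a (smono (ypol a k * q) k)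
          = - ((var GX * in_z q - in_z (zshift 1 q) * var GX) * nf_mono k)"
        by (simp only: nf_smono GX) (simp add: algebra_simps)
      then show ?thesis by (simp add: gwa_ideal_uminus gwa_ideal_mult_right rel_Xd)
    next
      case False
      have "ypol a k = a * zshift (- 1) (ypol a (k + 1))" using ypol_Suc [of "k + 1" a] False by simp
      then have "zshift 1 (ypol a k) = zshift 1 a * ypol a (k + 1)" by (simp add: zshift_mult)
      then have "ev_gen a g * smono (ypol a k * q) k =
          smono (ypol a (k + 1) * (zshift 1 q * zshift 1 a)) (k + 1)"
        by (simp add: GX smono_mult_smono zshift_mult ac_simps)
      moreover have "nf_mono k = var GY * (nf_mono (k + 1) :: 'k free_alg)"
      proof (cases "k = - 1")
        case False
        then have "nat (- k) = Suc (nat (- (k + 1)))" "\<not> 0 \<le> k" "\<not> 0 \<le> k + 1"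
          using \<open>\<not> 0 \<le> k\<close> by auto
        then show ?thesis unfolding nf_mono_def by (simp only: if_False power_Suc)
      qed (simp add: nf_mono_def)
      ultimately have "nf a (ev_gen a g * smono (ypol a k * q) k) - var g * nf a (smono (ypol a k * q) k)
          = - ((var GX * in_z q - in_z (zshift 1 q) * var GX) * (var GY * nf_mono (k + 1)))
            - in_z (zshift 1 q) * ((var GX * var GY - in_z (zshift 1 a)) * nf_mono (k + 1))"
        by (simp only: nf_smono GX in_z_mult) (simp add: algebra_simps)
      then show ?thesis
        by (simp add: gwa_ideal_diff gwa_ideal_uminus gwa_ideal_mult_left gwa_ideal_mult_right
            rel_Xd rel_XY)
    qed
  next
    case GY
    show ?thesis
    proof (cases "k \<le> 0")
      case True
      then have "ev_gen a g * smono (ypol a k * q) k = smono (ypol a (k - 1) * zshift (- 1) q) (k - 1)"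
        by (simp add: GY smono_mult_smono zshift_mult ypol_Suc mult.assoc)
      moreover have "nf_mono (k - 1) = var GY * (nf_mono k :: 'k free_alg)"
      proof (cases "k = 0")
        case False
        then have "nat (- (k - 1)) = Suc (nat (- k))" "\<not> 0 \<le> k" "\<not> 0 \<le> k - 1"
          using True by auto
        then show ?thesis unfolding nf_mono_def by (simp only: if_False power_Suc)
      qed (simp add: nf_mono_def)
      ultimately have "nf a (ev_gen a g * smono (ypol a k * q) k) - var g * nf a (smono (ypol a k * q) k)
          = - ((var GY * in_z q - in_z (zshift (- 1) q) * var GY) * nf_mono k)"
        by (simp only: nf_smono GY) (simp add: algebra_simps)
      then show ?thesis by (simp add: gwa_ideal_uminus gwa_ideal_mult_right rel_Yd)
    next
      case False
      then have "ev_gen a g * smono (ypol a k * q) k = smono (ypol a (k - 1) * (zshift (- 1) q * a)) (k - 1)"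
        by (simp add: GY smono_mult_smono mult.commute)
      moreover have "nf_mono k = var GX * (nf_mono (k - 1) :: 'k free_alg)"
      proof -
        have "nat k = Suc (nat (k - 1))" "0 \<le> k" "0 \<le> k - 1" using False by auto
        then show ?thesis unfolding nf_mono_def by (simp only: if_True power_Suc)
      qed
      ultimately have "nf a (ev_gen a g * smono (ypol a k * q) k) - var g * nf a (smono (ypol a k * q) k)
          = - ((var GY * in_z q - in_z (zshift (- 1) q) * var GY) * (var GX * nf_mono (k - 1)))
            - in_z (zshift (- 1) q) * ((var GY * var GX - in_z a) * nf_mono (k - 1))"
        by (simp only: nf_smono GY in_z_mult) (simp add: algebra_simps)
      then show ?thesis
        by (simp add: gwa_ideal_diff gwa_ideal_uminus gwa_ideal_mult_left gwa_ideal_mult_right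
            rel_Yd rel_YX)
    qed
  qed
qed

text \<open>
  Induction on the length of a word, one generator at a time from the right.
\<close>

lemma nf_ev:
  assumes "a \<noteq> 0"
  shows "nf a (ev a p) - p \<in> gwa_ideal shift a"
proof (induction p rule: free_alg_induct)
  case (add p q)
  then show ?case using gwa_ideal_add [OF add] by (simp add: ev_add nf_add algebra_simps)
next
  case (single w c)
  have "nf a (ev a (Poly_Mapping.single (Word gs) c)) - Poly_Mapping.single (Word gs) c
      \<in> gwa_ideal shift a" for gs
  proof (induction gs)
    case Nil
    have "ev a (const c) = smono (ypol a 0 * [:c:]) 0" by simp
    then have "nf a (ev a (const c)) = in_z [:c:] * nf_mono 0" by (simp only: nf_smono [OF assms])
    then have "nf a (ev a (const c)) = const c" by (simp add: nf_mono_def in_z_pCons)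
    then show ?case by (simp add: const_def zero_word_def gwa_ideal_0)
  next
    case (Cons g gs)
    define p where "p = Poly_Mapping.single (Word gs) c"
    have gp: "Poly_Mapping.single (Word (g # gs)) c = var g * p"
      by (simp add: p_def var_def mult_single plus_word_def)
    have "nf a (ev a (var g * p)) - var g * p =
        (nf a (ev_gen a g * ev a p) - var g * nf a (ev a p)) + var g * (nf a (ev a p) - p)"
      by (simp add: ev_mult algebra_simps)
    also have "\<dots> \<in> gwa_ideal shift a"
      using Cons unfolding p_def [symmetric]
      by (intro gwa_ideal_add gwa_ideal_mult_left nf_ev_gen_mult ev_in_gwa_sub assms)
    finally show ?case by (simp only: gp)
  qed
  from this [of "letters w"] show ?case by simp
qed

text \<open>
  The relations hold in the Laurent ring. Conversely, an element with value \<open>0\<close> is congruent to the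
  normal form of \<open>0\<close>, which is \<open>0\<close>.
\<close>

theorem gwa_ideal_eq_kernel:
  fixes a :: "'k::field_char_0 poly"
  assumes "a \<noteq> 0"
  shows "p \<in> gwa_ideal shift a \<longleftrightarrow> ev a p = 0"
proof
  assume "p \<in> gwa_ideal shift a"
  moreover have "ideal {p. ev a p = 0} free_alg"
  proof (rule idealI [OF ring_free_alg])
    have "inv\<^bsub>add_monoid free_alg\<^esub> p = - p" for p :: "'k free_alg"
      using a_minus_free_alg [of p] by (simp only: a_inv_def)
    then show "subgroup {p. ev a p = 0} (add_monoid free_alg)"
      by (intro group.subgroupI abelian_group.a_group ring.is_abelian_group [OF ring_free_alg])
        (auto simp: ev_add ev_uminus intro: ev_0)
  qed (auto simp: ev_mult)
  moreover have "gwa_rels shift a \<subseteq> {p. ev a p = 0}"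
    unfolding gwa_rels_def zshift_minus_one_eq [symmetric] unfolding zshift_one_eq_shift [symmetric]
    by (auto simp: ev_diff ev_mult smono_mult_smono mult.commute)
  ultimately show "ev a p = 0"
    using ring.genideal_minimal [OF ring_free_alg] unfolding gwa_ideal_def by blast
next
  assume "ev a p = 0"
  then show "p \<in> gwa_ideal shift a"
    using nf_ev [OF assms, of p] gwa_ideal_uminus [of "- p" shift a] by simp
qed

section \<open>The standard filtration in the skew Laurent ring\<close>

text \<open>
  Membership in the \<open>m\<close>-th piece of the standard filtration, for elements of the free algebra.
\<close>

definition weight_le :: "nat \<Rightarrow> nat \<Rightarrow> 'k::zero free_alg \<Rightarrow> bool" where
  "weight_le n m p \<longleftrightarrow> (\<forall>w\<in>Poly_Mapping.keys p. word_deg n w \<le> m)"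

lemma word_deg_add: "word_deg n (v + w) = word_deg n v + word_deg n w"
  by (simp add: word_deg_def plus_word_def)

lemma weight_le_0 [simp]: "weight_le n m 0"
  by (simp add: weight_le_def)

lemma weight_le_add: "weight_le n m p \<Longrightarrow> weight_le n m q \<Longrightarrow> weight_le n m (p + q)"
  using Poly_Mapping.keys_add [of p q] by (auto simp: weight_le_def)

lemma weight_le_sum: "(\<And>i. i \<in> A \<Longrightarrow> weight_le n m (f i)) \<Longrightarrow> weight_le n m (sum f A)"
  by (induction A rule: infinite_finite_induct) (auto simp: weight_le_add)

lemma weight_le_mult: "weight_le n m p \<Longrightarrow> weight_le n l q \<Longrightarrow> weight_le n (m + l) (p * q)"
  using keys_mult [of p q] by (fastforce simp: weight_le_def word_deg_add intro: add_mono)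

lemma weight_le_mono: "weight_le n m p \<Longrightarrow> m \<le> l \<Longrightarrow> weight_le n l p"
  by (force simp: weight_le_def)

lemma weight_le_const: "weight_le n m (const c)"
  by (auto simp: weight_le_def const_def word_deg_def zero_word_def)

lemma weight_le_var: "weight_le n (gen_deg n g) (var g)"
  by (auto simp: weight_le_def var_def word_deg_def)

lemma weight_le_power:
  fixes p :: "'k::field free_alg"
  shows "weight_le n m p \<Longrightarrow> weight_le n (i * m) (p ^ i)"
proof (induction i)
  case 0
  then show ?case using weight_le_const [of n 0 "1 :: 'k"] by simp
qed (simp add: weight_le_mult)

lemma weight_le_in_z: "weight_le n (2 * degree d) (in_z d)"
  unfolding in_z_def
proof (rule weight_le_sum)
  fix i assume "i \<in> {..degree d}"
  have "weight_le n (0 + i * gen_deg n GZ) (const (coeff d i) * var GZ ^ i)"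
    by (intro weight_le_mult weight_le_const weight_le_power weight_le_var)
  then show "weight_le n (2 * degree d) (const (coeff d i) * var GZ ^ i)"
    using \<open>i \<in> _\<close> by (elim weight_le_mono) simp
qed

lemma weight_le_nf_mono: "weight_le n (nat \<bar>k\<bar> * n) (nf_mono k)"
  using weight_le_power [OF weight_le_var [of n GX], of "nat k"]
    weight_le_power [OF weight_le_var [of n GY], of "nat (- k)"]
  by (auto simp: nf_mono_def abs_if)

text \<open>
  For \<open>k < 0\<close> the coefficient of \<open>x\<^sup>k\<close> is \<open>Y\<^sub>k q\<close> with \<open>deg Y\<^sub>k = n |k|\<close>, so the weight
  \<open>2 (n |k| + deg q) - n |k|\<close> of this term equals that of the words in \<open>q y\<^sup>-\<^sup>k\<close>.
\<close>

lemma weight_le_nf: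
  assumes "a \<noteq> 0" "s \<in> gwa_sub a" "s \<noteq> 0" and m: "sdeg (degree a) s \<le> int m"
  shows "weight_le (degree a) m (nf a s)"
  unfolding nf_def
proof (rule weight_le_sum)
  fix k assume k: "k \<in> supp s"
  define q where "q = scoeff s k div ypol a k"
  have sk: "scoeff s k = ypol a k * q"
    using assms(2) by (simp add: q_def gwa_sub_def)
  then have "q \<noteq> 0" using k by (auto simp: in_supp_iff)
  then have "degree (scoeff s k) = nat (- k) * degree a + degree q"
    by (simp add: sk degree_mult_eq ypol_nonzero degree_ypol assms(1))
  then have "int (2 * degree q + nat \<bar>k\<bar> * degree a) = wt (degree a) s k"
    by (cases "0 \<le> k") (auto simp: wt_def algebra_simps)
  also have "\<dots> \<le> int m" using wt_le_sdeg [OF k] m by (rule order.trans)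
  finally have "2 * degree q + nat \<bar>k\<bar> * degree a \<le> m" by (simp only: of_nat_le_iff)
  then show "weight_le (degree a) m (in_z q * nf_mono k)"
    using weight_le_mult [OF weight_le_in_z weight_le_nf_mono] weight_le_mono by blast
qed

lemma sdeg_smono: "p \<noteq> 0 \<Longrightarrow> sdeg n (smono p k) = 2 * int (degree p) + int n * k"
proof -
  assume "p \<noteq> 0"
  then have "supp (smono p k) = {k}" by (auto simp: in_supp_iff scoeff_smono split: if_splits)
  then show ?thesis by (simp add: sdeg_def wt_def)
qed

lemma sdeg_ev_word:
  fixes a :: "'k::field_char_0 poly"
  assumes "a \<noteq> 0"
  shows "ev_word a w \<noteq> 0 \<and> sdeg (degree a) (ev_word a w) = int (word_deg (degree a) w)"
proof -
  have gen: "ev_gen a g \<noteq> 0 \<and> sdeg (degree a) (ev_gen a g) = int (gen_deg (degree a) g)" for g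
    using assms by (cases g) (auto simp: sdeg_smono)
  have "prod_list (map (ev_gen a) gs) \<noteq> 0 \<and> sdeg (degree a) (prod_list (map (ev_gen a) gs)) =
      int (sum_list (map (gen_deg (degree a)) gs))" for gs
  proof (induction gs)
    case Nil
    show ?case using sdeg_smono [of "1 :: 'k poly" "degree a" 0] by (simp add: smono_1_0)
  next
    case (Cons g gs)
    then show ?case using gen [of g] by (simp add: sdeg_mult)
  qed
  then show ?thesis by (simp add: ev_word_def word_deg_def)
qed

lemma deg_below_ev:
  assumes "a \<noteq> 0" "weight_le (degree a) m p"
  shows "deg_below (degree a) (int m + 1) (ev a p)"
  unfolding ev_def
proof (rule deg_below_sum)
  fix w assume "w \<in> Poly_Mapping.keys p"
  then have "word_deg (degree a) w \<le> m" using assms(2) by (simp add: weight_le_def)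
  then show "deg_below (degree a) (int m + 1) (smono [:Poly_Mapping.lookup p w:] 0 * ev_word a w)"
    using sdeg_ev_word [OF assms(1), of w]
    by (cases "Poly_Mapping.lookup p w = 0") (auto simp: deg_below_iff sdeg_mult sdeg_smono)
qed

lemma (in outer_action) aus_skew_product:
  assumes F: "\<And>g. g \<in> carrier \<G> \<Longrightarrow> F g \<in> B" and F': "\<And>g. g \<in> carrier \<G> \<Longrightarrow> F' g \<in> B"
    and b: "b \<in> B"
  shows "aus (\<lambda>k. \<Sum>(g, h)\<in>{(g, h) \<in> carrier \<G> \<times> carrier \<G>. g \<otimes> h = k}. F g * act g (F' h)) b =
    aus F (aus F' b)"
proof -
  define G2 where "G2 = carrier \<G> \<times> carrier \<G>"
  define H where "H = (\<lambda>(g, h). F g * act g (F' h) * act (g \<otimes> h) b)"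
  have "aus (\<lambda>k. \<Sum>(g, h)\<in>{(g, h) \<in> carrier \<G> \<times> carrier \<G>. g \<otimes> h = k}. F g * act g (F' h)) b =
      (\<Sum>k\<in>carrier \<G>. sum H {x \<in> G2. (case x of (g, h) \<Rightarrow> g \<otimes> h) = k})"
    unfolding aus_def sum_distrib_right
    by (intro sum.cong refl) (auto simp: H_def G2_def)
  also have "\<dots> = sum H G2"
    by (rule sum.group) (auto simp: G2_def fin)
  also have "\<dots> = (\<Sum>g\<in>carrier \<G>. \<Sum>h\<in>carrier \<G>. F g * (act g (F' h) * act g (act h b)))"
    unfolding G2_def H_def sum.cartesian_product
    by (intro sum.cong refl) (auto simp: act_comp b mult.assoc)
  also have "\<dots> = aus F (aus F' b)"
    unfolding aus_def
    by (intro sum.cong refl)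
      (simp add: act_sum act_mult F' act_B b mult_B sum_distrib_left)
  finally show ?thesis .
qed

lemma (in outer_action) aus_add:
  "b \<in> B \<Longrightarrow> c \<in> B \<Longrightarrow> aus F (b + c) = aus F b + aus F c"
  by (simp add: aus_def act_add distrib_left sum.distrib)

lemma (in outer_action) aus_mult_fixed:
  "b \<in> B \<Longrightarrow> s \<in> fixed \<Longrightarrow> aus F (b * s) = aus F b * s"
  by (auto simp: aus_def fixed_def act_mult sum_distrib_right mult.assoc)

section \<open>Identification of the generalized Weyl algebra with its image\<close>

definition gwa_coset :: "'k::field_char_0 poly \<Rightarrow> 'k free_alg \<Rightarrow> 'k free_alg set" where
  "gwa_coset a p = gwa_ideal shift a +>\<^bsub>free_alg\<^esub> p"

lemma classical_gwa_simps:
  fixes a :: "'k::field_char_0 poly"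
  shows "carrier (classical_gwa a) = range (gwa_coset a)"
  "gwa_coset a p \<otimes>\<^bsub>classical_gwa a\<^esub> gwa_coset a q = gwa_coset a (p * q)"
  "gwa_coset a p \<oplus>\<^bsub>classical_gwa a\<^esub> gwa_coset a q = gwa_coset a (p + q)"
  "\<one>\<^bsub>classical_gwa a\<^esub> = gwa_coset a 1"
  "\<zero>\<^bsub>classical_gwa a\<^esub> = gwa_coset a 0"
  "c \<odot>\<^bsub>classical_gwa a\<^esub> r = gwa_coset a (const c) \<otimes>\<^bsub>classical_gwa a\<^esub> r"
proof -
  interpret ideal "gwa_ideal shift a" free_alg by (rule ideal_gwa_ideal)
  show "carrier (classical_gwa a) = range (gwa_coset a)"
    by (auto simp: classical_gwa_def gwa_def Let_def FactRing_def A_RCOSETS_def' gwa_coset_def)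
  show "gwa_coset a p \<otimes>\<^bsub>classical_gwa a\<^esub> gwa_coset a q = gwa_coset a (p * q)"
    using rcoset_mult_add [of p q]
    by (simp add: classical_gwa_def gwa_def Let_def FactRing_def gwa_coset_def)
  show "gwa_coset a p \<oplus>\<^bsub>classical_gwa a\<^esub> gwa_coset a q = gwa_coset a (p + q)"
    using a_rcos_sum [of p q]
    by (simp add: classical_gwa_def gwa_def Let_def FactRing_def gwa_coset_def)
  show "\<one>\<^bsub>classical_gwa a\<^esub> = gwa_coset a 1"
    by (simp add: classical_gwa_def gwa_def Let_def FactRing_def gwa_coset_def)
  have "gwa_coset a 0 = gwa_ideal shift a"
    by (simp add: gwa_coset_def a_r_coset_def r_coset_def)
  then show "\<zero>\<^bsub>classical_gwa a\<^esub> = gwa_coset a 0"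
    by (simp add: classical_gwa_def gwa_def Let_def FactRing_def)
  show "c \<odot>\<^bsub>classical_gwa a\<^esub> r = gwa_coset a (const c) \<otimes>\<^bsub>classical_gwa a\<^esub> r"
    by (simp add: classical_gwa_def gwa_def Let_def gwa_coset_def)
qed

lemma ring_classical_gwa:
  fixes a :: "'k::field_char_0 poly"
  shows "ring (classical_gwa a)"
proof (rule ringI)
  show "abelian_group (classical_gwa a)"
  proof (rule abelian_groupI)
    fix r assume "r \<in> carrier (classical_gwa a)"
    then obtain p where "r = gwa_coset a p" by (auto simp: classical_gwa_simps)
    then have "gwa_coset a (- p) \<oplus>\<^bsub>classical_gwa a\<^esub> r = \<zero>\<^bsub>classical_gwa a\<^esub>"
      by (simp add: classical_gwa_simps)
    then show "\<exists>s\<in>carrier (classical_gwa a). s \<oplus>\<^bsub>classical_gwa a\<^esub> r = \<zero>\<^bsub>classical_gwa a\<^esub>"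
      by (auto simp: classical_gwa_simps)
  qed (auto simp: classical_gwa_simps ac_simps)
  show "Group.monoid (classical_gwa a)"
    by (rule monoidI) (auto simp: classical_gwa_simps mult.assoc)
qed (auto simp: classical_gwa_simps distrib_left distrib_right)

lemma gwa_coset_eq_iff:
  assumes "a \<noteq> 0"
  shows "gwa_coset a p = gwa_coset a q \<longleftrightarrow> ev a p = ev a q"
proof -
  interpret ideal "gwa_ideal shift a" free_alg by (rule ideal_gwa_ideal)
  have "gwa_coset a p = gwa_coset a q \<longleftrightarrow> p - q \<in> gwa_ideal shift a"
    using quotient_eq_iff_same_a_r_cos [OF ideal_gwa_ideal [of shift a], of p q]
    by (simp add: gwa_coset_def a_minus_def)
  then show ?thesis by (simp add: gwa_ideal_eq_kernel [OF assms] ev_diff)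
qed

text \<open>
  Evaluation factors through the quotient; the value does not depend on the representative that is
  chosen here.
\<close>

definition rep :: "'k::field_char_0 poly \<Rightarrow> 'k free_alg set \<Rightarrow> 'k skew_laurent" where
  "rep a r = ev a (SOME p. r = gwa_coset a p)"

definition unrep :: "'k::field_char_0 poly \<Rightarrow> 'k skew_laurent \<Rightarrow> 'k free_alg set" where
  "unrep a s = gwa_coset a (nf a s)"

lemma rep_gcos: "a \<noteq> 0 \<Longrightarrow> rep a (gwa_coset a p) = ev a p"
  unfolding rep_def by (rule someI2 [of _ p]) (auto simp: gwa_coset_eq_iff)

lemma unrep_in_carrier: "unrep a s \<in> carrier (classical_gwa a)"
  by (simp add: unrep_def classical_gwa_simps)

context
  fixes a :: "'k::field_char_0 poly"
  assumes a_nonzero: "a \<noteq> 0"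
begin

lemma rep_in_gwa_sub: "r \<in> carrier (classical_gwa a) \<Longrightarrow> rep a r \<in> gwa_sub a"
  and rep_mult: "r \<in> carrier (classical_gwa a) \<Longrightarrow> s \<in> carrier (classical_gwa a) \<Longrightarrow>
    rep a (r \<otimes>\<^bsub>classical_gwa a\<^esub> s) = rep a r * rep a s"
  and rep_add: "r \<in> carrier (classical_gwa a) \<Longrightarrow> s \<in> carrier (classical_gwa a) \<Longrightarrow>
    rep a (r \<oplus>\<^bsub>classical_gwa a\<^esub> s) = rep a r + rep a s"
  and rep_one: "rep a \<one>\<^bsub>classical_gwa a\<^esub> = 1"
  and rep_zero: "rep a \<zero>\<^bsub>classical_gwa a\<^esub> = 0"
  and rep_unrep: "t \<in> gwa_sub a \<Longrightarrow> rep a (unrep a t) = t"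
  using a_nonzero
  by (auto simp: classical_gwa_simps rep_gcos [OF a_nonzero] gwa_coset_eq_iff [OF a_nonzero] ev_in_gwa_sub
      ev_mult ev_add unrep_def ev_nf)

lemma rep_eq_iff:
  assumes "r \<in> carrier (classical_gwa a)" "s \<in> carrier (classical_gwa a)"
  shows "rep a r = rep a s \<longleftrightarrow> r = s"
proof -
  obtain p q where "r = gwa_coset a p" "s = gwa_coset a q" using assms by (auto simp: classical_gwa_simps)
  then show ?thesis by (simp add: rep_gcos [OF a_nonzero] gwa_coset_eq_iff [OF a_nonzero])
qed

lemma unrep_rep: "r \<in> carrier (classical_gwa a) \<Longrightarrow> unrep a (rep a r) = r"
  using rep_eq_iff [of "unrep a (rep a r)" r] by (simp add: unrep_in_carrier rep_unrep rep_in_gwa_sub)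

lemma rep_finsum:
  assumes "finite A" "\<And>i. i \<in> A \<Longrightarrow> f i \<in> carrier (classical_gwa a)"
  shows "rep a (finsum (classical_gwa a) f A) = (\<Sum>i\<in>A. rep a (f i))"
proof -
  interpret ring "classical_gwa a" by (rule ring_classical_gwa)
  show ?thesis
    using assms
  proof (induction A rule: finite_induct)
    case (insert i A)
    then have "finsum (classical_gwa a) f (insert i A) = f i \<oplus>\<^bsub>classical_gwa a\<^esub> finsum (classical_gwa a) f A"
      by (intro finsum_insert) auto
    moreover have "finsum (classical_gwa a) f A \<in> carrier (classical_gwa a)"
      using insert by (intro finsum_closed) auto
    ultimately show ?case using insert by (simp add: rep_add)
  qed (simp add: rep_zero)
qed

text \<open>
  Words of weight at most \<open>m\<close> have values of degree at most \<open>m\<close>; conversely, the normal form is a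
  representative whose words have small weight.
\<close>

lemma std_filtration_iff:
  assumes "r \<in> carrier (classical_gwa a)" "rep a r \<noteq> 0"
  shows "r \<in> std_filtration a m \<longleftrightarrow> sdeg (degree a) (rep a r) \<le> int m"
proof
  assume "r \<in> std_filtration a m"
  then obtain p where "r = gwa_coset a p" "weight_le (degree a) m p"
    by (auto simp: std_filtration_def gwa_coset_def weight_le_def)
  then show "sdeg (degree a) (rep a r) \<le> int m"
    using deg_below_ev [OF a_nonzero, of m p] assms(2) a_nonzero by (auto simp: rep_gcos deg_below_iff)
next
  assume "sdeg (degree a) (rep a r) \<le> int m"
  then have "weight_le (degree a) m (nf a (rep a r))"
    using a_nonzero assms by (intro weight_le_nf rep_in_gwa_sub)
  moreover have "r = gwa_coset a (nf a (rep a r))" using unrep_rep [OF assms(1)] by (simp add: unrep_def)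
  ultimately show "r \<in> std_filtration a m"
    by (auto simp: std_filtration_def gwa_coset_def weight_le_def)
qed

lemma std_deg_eq:
  assumes "r \<in> carrier (classical_gwa a)" "rep a r \<noteq> 0"
  shows "int (std_deg a r) = sdeg (degree a) (rep a r)"
proof -
  have "0 \<le> sdeg (degree a) (rep a r)"
    using assms a_nonzero by (intro sdeg_nonneg rep_in_gwa_sub)
  moreover have "std_deg a r = nat (sdeg (degree a) (rep a r))"
    unfolding std_deg_def
    by (rule Least_equality) (use calculation in \<open>auto simp: std_filtration_iff [OF assms]\<close>)
  ultimately show ?thesis by simp
qed

end

section \<open>The Auslander map\<close>

text \<open>
  The group is carried over to the image \<open>gwa_sub a\<close> in the Laurent ring, where it is an instance of
  the outer actions studied above.
\<close>

locale gwa_action =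
  fixes a :: "'k::{alg_closed_field, field_char_0} poly"
    and G :: "('k free_alg set \<Rightarrow> 'k free_alg set) set"
  assumes a_nonzero: "a \<noteq> 0"
    and G_subgroup: "subgroup G (Aut_fl a)"
    and G_finite: "finite G"
begin

abbreviation "R \<equiv> classical_gwa a"

definition act :: "('k free_alg set \<Rightarrow> 'k free_alg set) \<Rightarrow> 'k skew_laurent \<Rightarrow> 'k skew_laurent" where
  "act g s = rep a (g (unrep a s))"

lemmas rep_simps = rep_in_gwa_sub [OF a_nonzero] rep_mult [OF a_nonzero] rep_add [OF a_nonzero]
  rep_one [OF a_nonzero] rep_zero [OF a_nonzero] rep_unrep [OF a_nonzero] unrep_rep [OF a_nonzero]
  unrep_in_carrier

lemma G_auts: "G \<subseteq> filtered_auts a"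
  using subgroup.subset [OF G_subgroup] by (simp add: Aut_fl_def)

lemma G_props:
  assumes "g \<in> G"
  shows G_bij: "bij_betw g (carrier R) (carrier R)"
    and G_closed: "r \<in> carrier R \<Longrightarrow> g r \<in> carrier R"
    and G_mult: "r \<in> carrier R \<Longrightarrow> s \<in> carrier R \<Longrightarrow> g (r \<otimes>\<^bsub>R\<^esub> s) = g r \<otimes>\<^bsub>R\<^esub> g s"
    and G_add: "r \<in> carrier R \<Longrightarrow> s \<in> carrier R \<Longrightarrow> g (r \<oplus>\<^bsub>R\<^esub> s) = g r \<oplus>\<^bsub>R\<^esub> g s"
    and G_one: "g \<one>\<^bsub>R\<^esub> = \<one>\<^bsub>R\<^esub>"
    and G_deg: "r \<in> carrier R \<Longrightarrow> std_deg a (g r) = std_deg a r"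
    and G_ext: "g \<in> extensional (carrier R)"
    and G_Bij: "g \<in> Bij (carrier R)"
proof -
  have hom: "g \<in> ring_hom R R" and bij: "bij_betw g (carrier R) (carrier R)"
    and ext: "g \<in> extensional (carrier R)"
    and deg: "r \<in> carrier R \<Longrightarrow> std_deg a (g r) = std_deg a r" for r
    using G_auts assms by (auto simp: filtered_auts_def alg_iso_def ring_iso_def)
  show "bij_betw g (carrier R) (carrier R)" by (rule bij)
  show "r \<in> carrier R \<Longrightarrow> g r \<in> carrier R" by (rule ring_hom_closed [OF hom])
  show "r \<in> carrier R \<Longrightarrow> s \<in> carrier R \<Longrightarrow> g (r \<otimes>\<^bsub>R\<^esub> s) = g r \<otimes>\<^bsub>R\<^esub> g s"
    by (rule ring_hom_mult [OF hom])
  show "r \<in> carrier R \<Longrightarrow> s \<in> carrier R \<Longrightarrow> g (r \<oplus>\<^bsub>R\<^esub> s) = g r \<oplus>\<^bsub>R\<^esub> g s"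
    by (rule ring_hom_add [OF hom])
  show "g \<one>\<^bsub>R\<^esub> = \<one>\<^bsub>R\<^esub>" by (rule ring_hom_one [OF hom])
  show "r \<in> carrier R \<Longrightarrow> std_deg a (g r) = std_deg a r" by (rule deg)
  show "g \<in> extensional (carrier R)" by (rule ext)
  show "g \<in> Bij (carrier R)" using bij ext by (simp add: Bij_def)
qed

lemma G_simps:
  "carrier (Aut_fl a\<lparr>carrier := G\<rparr>) = G"
  "\<one>\<^bsub>Aut_fl a\<lparr>carrier := G\<rparr>\<^esub> = (\<lambda>r\<in>carrier R. r)"
  "g \<in> G \<Longrightarrow> h \<in> G \<Longrightarrow> g \<otimes>\<^bsub>Aut_fl a\<lparr>carrier := G\<rparr>\<^esub> h = compose (carrier R) g h"
  "g \<in> G \<Longrightarrow> h \<in> G \<Longrightarrow> g \<otimes>\<^bsub>Aut_fl a\<^esub> h = compose (carrier R) g h"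
  by (auto simp: Aut_fl_def BijGroup_def G_Bij)

lemma one_in_G: "(\<lambda>r\<in>carrier R. r) \<in> G"
  using subgroup.one_closed [OF G_subgroup] by (simp only: Aut_fl_def BijGroup_def) simp

lemma compose_in_G: "g \<in> G \<Longrightarrow> h \<in> G \<Longrightarrow> compose (carrier R) g h \<in> G"
  using subgroup.m_closed [OF G_subgroup] by (simp add: G_simps(4))

text \<open>
  In a finite set of bijections that is closed under composition, composing with \<open>g\<close> on the right is
  injective and hence onto, so \<open>g\<close> has a left inverse in the set.
\<close>

lemma G_group: "group (Aut_fl a\<lparr>carrier := G\<rparr>)"
proof (rule groupI, unfold G_simps(1,2))
  fix g assume g: "g \<in> G"
  have "inj_on (\<lambda>h. compose (carrier R) h g) G"
  proof (rule inj_onI)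
    fix h h' assume h: "h \<in> G" "h' \<in> G" and eq: "compose (carrier R) h g = compose (carrier R) h' g"
    have "h r = h' r" if "r \<in> carrier R" for r
    proof -
      have "r \<in> g ` carrier R" using bij_betw_imp_surj_on [OF G_bij [OF g]] that by simp
      then obtain s where s: "s \<in> carrier R" "r = g s" by blast
      have "compose (carrier R) h g s = compose (carrier R) h' g s" by (rule fun_cong [OF eq])
      then show ?thesis by (simp only: compose_eq [OF s(1)] s(2))
    qed
    then show "h = h'" by (rule extensionalityI [OF G_ext [OF h(1)] G_ext [OF h(2)]])
  qed
  then have "(\<lambda>h. compose (carrier R) h g) ` G = G"
    using g by (intro endo_inj_surj G_finite) (auto simp: compose_in_G)
  then have "(\<lambda>r\<in>carrier R. r) \<in> (\<lambda>h. compose (carrier R) h g) ` G"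
    using one_in_G by (rule ssubst)
  then obtain h where h: "h \<in> G" "(\<lambda>r\<in>carrier R. r) = compose (carrier R) h g" by (rule imageE)
  have "h \<otimes>\<^bsub>Aut_fl a\<lparr>carrier := G\<rparr>\<^esub> g = (\<lambda>r\<in>carrier R. r)"
    by (rule trans [OF G_simps(3) [OF h(1) g] h(2) [symmetric]])
  then show "\<exists>h\<in>G. h \<otimes>\<^bsub>Aut_fl a\<lparr>carrier := G\<rparr>\<^esub> g = (\<lambda>r\<in>carrier R. r)"
    using h(1) by (rule bexI)
next
  fix g h k assume ghk: "g \<in> G" "h \<in> G" "k \<in> G"
  have "compose (carrier R) (compose (carrier R) g h) k = compose (carrier R) g (compose (carrier R) h k)"
    by (rule compose_assoc [symmetric, of k "carrier R" "carrier R"]) (use G_closed [OF ghk(3)] in blast)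
  then show "g \<otimes>\<^bsub>Aut_fl a\<lparr>carrier := G\<rparr>\<^esub> h \<otimes>\<^bsub>Aut_fl a\<lparr>carrier := G\<rparr>\<^esub> k =
      g \<otimes>\<^bsub>Aut_fl a\<lparr>carrier := G\<rparr>\<^esub> (h \<otimes>\<^bsub>Aut_fl a\<lparr>carrier := G\<rparr>\<^esub> k)"
    using ghk by (simp only: G_simps(3) compose_in_G)
next
  fix g assume g: "g \<in> G"
  have "compose (carrier R) (\<lambda>r\<in>carrier R. r) g = g"
    by (rule Id_compose [OF _ G_ext [OF g]]) (use G_closed [OF g] in blast)
  then show "(\<lambda>r\<in>carrier R. r) \<otimes>\<^bsub>Aut_fl a\<lparr>carrier := G\<rparr>\<^esub> g = g"
    by (rule trans [OF G_simps(3) [OF one_in_G g]])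
qed (simp_all only: G_simps(3) compose_in_G one_in_G)

lemma act_rep: "r \<in> carrier R \<Longrightarrow> act g (rep a r) = rep a (g r)"
  by (simp add: act_def rep_simps)

lemma rep_exists: "s \<in> gwa_sub a \<Longrightarrow> \<exists>r\<in>carrier R. s = rep a r"
  by (metis rep_unrep [OF a_nonzero] unrep_in_carrier)

lemma act_closed: "g \<in> G \<Longrightarrow> s \<in> gwa_sub a \<Longrightarrow> act g s \<in> gwa_sub a"
  by (auto simp: act_rep rep_simps G_closed dest!: rep_exists)

lemma act_add_aux: "g \<in> G \<Longrightarrow> s \<in> gwa_sub a \<Longrightarrow> t \<in> gwa_sub a \<Longrightarrow> act g (s + t) = act g s + act g t"
proof -
  interpret R: ring R by (rule ring_classical_gwa)
  assume "g \<in> G" "s \<in> gwa_sub a" "t \<in> gwa_sub a"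
  then show ?thesis
    by (auto simp: act_rep rep_simps G_closed G_add rep_add [OF a_nonzero, symmetric]
        simp del: rep_simps(3) dest!: rep_exists)
qed

lemma act_mult_aux: "g \<in> G \<Longrightarrow> s \<in> gwa_sub a \<Longrightarrow> t \<in> gwa_sub a \<Longrightarrow> act g (s * t) = act g s * act g t"
proof -
  interpret R: ring R by (rule ring_classical_gwa)
  assume "g \<in> G" "s \<in> gwa_sub a" "t \<in> gwa_sub a"
  then show ?thesis
    by (auto simp: act_rep G_closed G_mult rep_mult [OF a_nonzero, symmetric] dest!: rep_exists)
qed

lemma act_one_aux: "g \<in> G \<Longrightarrow> act g 1 = 1"
  using act_rep [of "\<one>\<^bsub>R\<^esub>" g] ring.ring_simprules(6) [OF ring_classical_gwa [of a]]
  by (simp add: G_one rep_one [OF a_nonzero])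

lemma act_comp_aux:
  "g \<in> G \<Longrightarrow> h \<in> G \<Longrightarrow> s \<in> gwa_sub a \<Longrightarrow> act (compose (carrier R) g h) s = act g (act h s)"
  by (auto simp: act_rep G_closed compose_eq dest!: rep_exists)

lemma act_outer:
  assumes g: "g \<in> G" "g \<noteq> (\<lambda>r\<in>carrier R. r)"
    and r: "r \<in> gwa_sub a" "r \<noteq> 0" and d: "d \<in> gwa_sub a" "d \<noteq> 0"
  shows "\<exists>b\<in>gwa_sub a. r * act g b * act g d \<noteq> d * b * r"
proof (rule ccontr)
  assume contra: "\<not> ?thesis"
  interpret \<G>: group "Aut_fl a\<lparr>carrier := G\<rparr>" by (rule G_group)
  \<comment> \<open>Preservation of the standard degree means preservation of the degree of the Laurent ring.\<close>
  have deg: "act g b \<noteq> 0 \<and> sdeg (degree a) (act g b) = sdeg (degree a) b"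
    if b: "b \<in> gwa_sub a" "b \<noteq> 0" for b
  proof -
    obtain s where s: "s \<in> carrier R" "b = rep a s" using rep_exists b by blast
    have gs: "g s \<in> carrier R" using s g by (simp add: G_closed)
    have "rep a (g s) \<noteq> 0"
    proof
      assume "rep a (g s) = 0"
      have z: "\<zero>\<^bsub>R\<^esub> \<in> carrier R" by (simp add: classical_gwa_simps)
      have "g \<zero>\<^bsub>R\<^esub> \<in> carrier R" using g z by (simp add: G_closed)
      moreover have "rep a (g \<zero>\<^bsub>R\<^esub>) = 0"
        using act_add_aux [OF g(1) gwa_sub_0 gwa_sub_0] act_rep [OF z, of g] by (simp add: rep_zero [OF a_nonzero])
      ultimately have "g s = g \<zero>\<^bsub>R\<^esub>"
        using \<open>rep a (g s) = 0\<close> gs rep_eq_iff [OF a_nonzero] by metis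
      then have "s = \<zero>\<^bsub>R\<^esub>" using G_bij [OF g(1)] s z by (auto simp: bij_betw_def dest: inj_onD)
      then show False using b s by (simp add: rep_zero [OF a_nonzero])
    qed
    then show ?thesis
      using s b g gs std_deg_eq [OF a_nonzero gs] std_deg_eq [OF a_nonzero s(1)] G_deg [OF g(1) s(1)]
      by (simp add: act_rep)
  qed
  have pow: "(act g ^^ i) b = act (g [^]\<^bsub>Aut_fl a\<lparr>carrier := G\<rparr>\<^esub> i) b \<and>
      (g [^]\<^bsub>Aut_fl a\<lparr>carrier := G\<rparr>\<^esub> i) \<in> G" if b: "b \<in> gwa_sub a" for i b
    using b
  proof (induction i arbitrary: b)
    case 0
    obtain r where "r \<in> carrier R" "b = rep a r" using rep_exists [OF 0] by blast
    then have "(act g ^^ 0) b = act (\<lambda>r\<in>carrier R. r) b" by (simp add: act_rep)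
    moreover have "(\<lambda>r\<in>carrier R. r) \<in> G" using \<G>.one_closed by (simp only: G_simps(1,2))
    ultimately show ?case by (simp only: \<G>.nat_pow_0 G_simps(2) simp_thms)
  next
    case (Suc i)
    have "(act g ^^ Suc i) b = (act g ^^ i) (act g b)" by (simp add: funpow_swap1)
    then show ?case
      using Suc.IH [of "act g b"] Suc.prems g \<G>.m_closed [of "g [^]\<^bsub>Aut_fl a\<lparr>carrier := G\<rparr>\<^esub> i" g]
      by (auto simp: G_simps act_closed act_comp_aux)
  qed
  \<comment> \<open>Two powers of \<open>g\<close> coincide as the group is finite, so \<open>g\<close> has finite order.\<close>
  let ?p = "\<lambda>i::nat. g [^]\<^bsub>Aut_fl a\<lparr>carrier := G\<rparr>\<^esub> i"
  have g': "g \<in> carrier (Aut_fl a\<lparr>carrier := G\<rparr>)" using g by (simp only: G_simps(1))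
  have p_in: "?p i \<in> carrier (Aut_fl a\<lparr>carrier := G\<rparr>)" for i by (rule \<G>.nat_pow_closed [OF g'])
  then have "range ?p \<subseteq> G" by (auto simp only: G_simps(1))
  then have "\<not> inj ?p" using G_finite finite_imageD [of ?p UNIV] finite_subset by blast
  then obtain i j where ij: "i < j" "?p i = ?p j" by (metis injI linorder_neqE_nat)
  define N where "N = j - i"
  have "N > 0" using ij(1) by (simp add: N_def)
  have "?p N \<otimes>\<^bsub>Aut_fl a\<lparr>carrier := G\<rparr>\<^esub> ?p i = ?p i"
    using \<G>.nat_pow_mult [OF g', of N i] ij by (simp add: N_def)
  then have "?p N = \<one>\<^bsub>Aut_fl a\<lparr>carrier := G\<rparr>\<^esub>"
    using \<G>.r_cancel_one [OF p_in p_in] by blast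
  then have order: "(act g ^^ N) b = b" if "b \<in> gwa_sub a" for b
    using pow [OF that, of N] that by (auto simp: G_simps act_rep dest!: rep_exists)
  have "act g b = b" if "b \<in> gwa_sub a" for b
    by (rule filtered_finite_order_outer [OF a_nonzero _ _ _ _ \<open>N > 0\<close> order r d _ that])
      (use contra g deg in \<open>auto simp: act_closed act_add_aux act_one_aux\<close>)
  then have "g s = s" if "s \<in> carrier R" for s
    using that g act_rep [OF that, of g]
    by (metis G_closed a_nonzero rep_eq_iff rep_in_gwa_sub)
  then have "g = (\<lambda>r\<in>carrier R. r)"
    using G_ext [OF g(1)] by (auto intro: extensionalityI)
  then show False using g by simp
qed

sublocale outer_action "Aut_fl a\<lparr>carrier := G\<rparr>" "gwa_sub a" act
proof (intro outer_action.intro outer_action_axioms.intro G_group, unfold G_simps(1,2))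
  show "act (\<lambda>r\<in>carrier R. r) b = b" if "b \<in> gwa_sub a" for b
    using that by (auto simp: act_rep dest!: rep_exists)
qed (simp_all add: G_finite gwa_sub_1 gwa_sub_diff gwa_sub_mult act_closed act_add_aux act_mult_aux
    act_one_aux G_simps(4) act_comp_aux act_outer)

lemma auslander_closed:
  assumes "f \<in> G \<rightarrow> carrier R" "b \<in> carrier R"
  shows "auslander_map R G f b \<in> carrier R"
    and rep_auslander: "rep a (auslander_map R G f b) = aus (\<lambda>g. rep a (f g)) (rep a b)"
proof -
  interpret R: ring R by (rule ring_classical_gwa)
  have mem: "f g \<in> carrier R" "g b \<in> carrier R" if "g \<in> G" for g
    using assms that by (auto simp: G_closed)
  then show "auslander_map R G f b \<in> carrier R"
    using assms by (auto simp: auslander_map_def intro!: R.finsum_closed)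
  show "rep a (auslander_map R G f b) = aus (\<lambda>g. rep a (f g)) (rep a b)"
    using mem assms
    by (simp add: auslander_map_def rep_finsum [OF a_nonzero] G_finite aus_def G_simps(1)
        rep_simps act_rep)
qed

lemma auslander_eqI:
  assumes "f \<in> G \<rightarrow> carrier R" "t \<in> extensional (carrier R)"
    and "\<And>b. b \<in> carrier R \<Longrightarrow> t b \<in> carrier R"
    and "\<And>b. b \<in> carrier R \<Longrightarrow> aus (\<lambda>g. rep a (f g)) (rep a b) = rep a (t b)"
  shows "auslander_map R G f = t"
proof (rule extensionalityI)
  show "auslander_map R G f \<in> extensional (carrier R)" by (simp add: auslander_map_def)
  show "auslander_map R G f b = t b" if b: "b \<in> carrier R" for b
    using assms(3,4) [OF b] rep_auslander [OF assms(1) b] auslander_closed [OF assms(1) b]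
      rep_eq_iff [OF a_nonzero] by metis
qed (rule assms)

lemma fixed_ring_iff: "s \<in> fixed_ring R G \<longleftrightarrow> s \<in> carrier R \<and> rep a s \<in> fixed"
  by (auto simp: fixed_ring_def fixed_def G_simps(1) rep_simps act_rep rep_eq_iff [OF a_nonzero] G_closed)

lemma auslander_in_End:
  assumes f: "f \<in> G \<rightarrow> carrier R"
  shows "auslander_map R G f \<in> carrier (right_End (fixed_ring R G) R)"
proof -
  interpret R: ring R by (rule ring_classical_gwa)
  have add: "auslander_map R G f (r \<oplus>\<^bsub>R\<^esub> s) = auslander_map R G f r \<oplus>\<^bsub>R\<^esub> auslander_map R G f s"
    if "r \<in> carrier R" "s \<in> carrier R" for r s
    using that f
    by (simp add: rep_eq_iff [OF a_nonzero, symmetric] auslander_closed rep_auslander rep_simps aus_add)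
  have mult: "auslander_map R G f (r \<otimes>\<^bsub>R\<^esub> s) = auslander_map R G f r \<otimes>\<^bsub>R\<^esub> s"
    if "r \<in> carrier R" "s \<in> fixed_ring R G" for r s
    using that f
    by (simp add: rep_eq_iff [OF a_nonzero, symmetric] auslander_closed rep_auslander rep_simps
        aus_mult_fixed fixed_ring_iff)
  show ?thesis
    using f add mult by (auto simp: right_End_def auslander_closed) (simp_all add: auslander_map_def)
qed

text \<open>
  The algebraic identities are checked after applying the embedding into the Laurent ring. Bijectivity
  is the injectivity and surjectivity of \<open>aus\<close>; surjectivity uses that homomorphisms from ideals to
  \<open>R\<close> are multiplications.
\<close>

theorem auslander_map_iso:
  "auslander_map R G \<in> alg_iso (skew_group_algebra R G) (right_End (fixed_ring R G) R)"
proof -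
  interpret R: ring R by (rule ring_classical_gwa)
  let ?S = "skew_group_algebra R G" and ?E = "right_End (fixed_ring R G) R"
  have carr: "carrier ?S = (G \<rightarrow>\<^sub>E carrier R)" by (simp add: skew_group_algebra_def)
  have funs: "f \<in> G \<rightarrow> carrier R" if "f \<in> carrier ?S" for f using that by (auto simp: carr)
  have rep_f: "rep a (f g) \<in> gwa_sub a" if "f \<in> carrier ?S" "g \<in> G" for f g
    using funs [OF that(1)] that(2) by (intro rep_in_gwa_sub [OF a_nonzero]) auto
  have hom: "auslander_map R G \<in> ring_hom ?S ?E"
  proof (rule ring_hom_memI)
    fix f assume f: "f \<in> carrier ?S"
    show "auslander_map R G f \<in> carrier ?E" using auslander_in_End funs [OF f] .
    fix f' assume f': "f' \<in> carrier ?S"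
    show "auslander_map R G (f \<oplus>\<^bsub>?S\<^esub> f') = auslander_map R G f \<oplus>\<^bsub>?E\<^esub> auslander_map R G f'"
    proof (rule auslander_eqI)
      show "f \<oplus>\<^bsub>?S\<^esub> f' \<in> G \<rightarrow> carrier R" 
        using funs [OF f] funs [OF f'] by (auto simp: skew_group_algebra_def)
      fix b assume b: "b \<in> carrier R"
      have "rep a ((f \<oplus>\<^bsub>?S\<^esub> f') g) = rep a (f g) + rep a (f' g)" if "g \<in> G" for g
        using that funs [OF f] funs [OF f'] by (auto simp: skew_group_algebra_def rep_simps Pi_iff)
      then show "aus (\<lambda>g. rep a ((f \<oplus>\<^bsub>?S\<^esub> f') g)) (rep a b) =
          rep a ((auslander_map R G f \<oplus>\<^bsub>?E\<^esub> auslander_map R G f') b)"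
        using b funs [OF f] funs [OF f']
        by (simp add: right_End_def rep_simps auslander_closed rep_auslander aus_def G_simps(1)
            distrib_right sum.distrib)
    qed (use funs [OF f] funs [OF f'] in \<open>auto simp: right_End_def auslander_closed\<close>)
    show "auslander_map R G (f \<otimes>\<^bsub>?S\<^esub> f') = auslander_map R G f \<otimes>\<^bsub>?E\<^esub> auslander_map R G f'"
    proof (rule auslander_eqI)
      have closed: "f g \<otimes>\<^bsub>R\<^esub> g (f' h) \<in> carrier R" if "g \<in> G" "h \<in> G" for g h
        using that funs [OF f] funs [OF f'] by (intro R.m_closed G_closed [OF that(1)]) auto
      show "f \<otimes>\<^bsub>?S\<^esub> f' \<in> G \<rightarrow> carrier R"
        using closed by (auto simp: skew_group_algebra_def intro!: R.finsum_closed)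
      fix b assume b: "b \<in> carrier R"
      have "rep a ((f \<otimes>\<^bsub>?S\<^esub> f') k) =
          (\<Sum>(g, h)\<in>{(g, h) \<in> G \<times> G. g \<otimes>\<^bsub>Aut_fl a\<lparr>carrier := G\<rparr>\<^esub> h = k}. rep a (f g) * act g (rep a (f' h)))"
        if k: "k \<in> G" for k
      proof -
        have "finite {(g, h) \<in> G \<times> G. compose (carrier R) g h = k}"
          by (rule finite_subset [of _ "G \<times> G"]) (auto simp: G_finite)
        then have "rep a ((f \<otimes>\<^bsub>?S\<^esub> f') k) = (\<Sum>(g, h)\<in>{(g, h) \<in> G \<times> G. compose (carrier R) g h = k}.
            rep a (f g \<otimes>\<^bsub>R\<^esub> g (f' h)))"
          using k closed
          by (simp add: skew_group_algebra_def, subst rep_finsum [OF a_nonzero]) (auto intro!: sum.cong)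
        also have "\<dots> = (\<Sum>(g, h)\<in>{(g, h) \<in> G \<times> G. g \<otimes>\<^bsub>Aut_fl a\<lparr>carrier := G\<rparr>\<^esub> h = k}.
            rep a (f g) * act g (rep a (f' h)))"
          using funs [OF f] funs [OF f']
          by (intro sum.cong) (auto simp: G_simps(4) rep_simps act_rep G_closed Pi_iff)
        finally show ?thesis .
      qed
      then have "aus (\<lambda>g. rep a ((f \<otimes>\<^bsub>?S\<^esub> f') g)) (rep a b) =
          aus (\<lambda>g. rep a (f g)) (aus (\<lambda>g. rep a (f' g)) (rep a b))"
        using aus_skew_product [of "\<lambda>g. rep a (f g)" "\<lambda>g. rep a (f' g)" "rep a b"] b f f'
        by (simp add: G_simps(1) rep_f rep_simps aus_def cong: sum.cong)
      then show "aus (\<lambda>g. rep a ((f \<otimes>\<^bsub>?S\<^esub> f') g)) (rep a b) =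
          rep a ((auslander_map R G f \<otimes>\<^bsub>?E\<^esub> auslander_map R G f') b)"
        using b funs [OF f] funs [OF f']
        by (simp add: right_End_def compose_eq auslander_closed rep_auslander)
    qed (use funs [OF f] funs [OF f'] in \<open>auto simp: right_End_def compose_eq auslander_closed\<close>)
  next
    show "auslander_map R G \<one>\<^bsub>?S\<^esub> = \<one>\<^bsub>?E\<^esub>"
    proof (rule auslander_eqI)
      fix b assume b: "b \<in> carrier R"
      have "aus (\<lambda>g. rep a (\<one>\<^bsub>?S\<^esub> g)) (rep a b) =
          (\<Sum>g\<in>G. if g = (\<lambda>r\<in>carrier R. r) then rep a b else 0)"
        unfolding aus_def G_simps(1) using b
        by (intro sum.cong) (auto simp: skew_group_algebra_def rep_simps act_rep)
      then show "aus (\<lambda>g. rep a (\<one>\<^bsub>?S\<^esub> g)) (rep a b) = rep a (\<one>\<^bsub>?E\<^esub> b)"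
        using G_finite one_in_G b by (simp add: right_End_def)
    qed (auto simp: right_End_def skew_group_algebra_def)
  qed
  have smult: "auslander_map R G (c \<odot>\<^bsub>?S\<^esub> f) = c \<odot>\<^bsub>?E\<^esub> auslander_map R G f"
    if f: "f \<in> carrier ?S" for c f
  proof (rule auslander_eqI)
    have c: "gwa_coset a (const c) \<in> carrier R" by (simp add: classical_gwa_simps)
    have sm: "c \<odot>\<^bsub>R\<^esub> r = gwa_coset a (const c) \<otimes>\<^bsub>R\<^esub> r" for r by (rule classical_gwa_simps)
    show "c \<odot>\<^bsub>?S\<^esub> f \<in> G \<rightarrow> carrier R"
      using funs [OF f] c by (auto simp: skew_group_algebra_def sm)
    show "(c \<odot>\<^bsub>?E\<^esub> auslander_map R G f) b \<in> carrier R" if "b \<in> carrier R" for b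
      using that funs [OF f] c by (auto simp: right_End_def sm auslander_closed)
    fix b assume b: "b \<in> carrier R"
    have "rep a ((c \<odot>\<^bsub>?S\<^esub> f) g) = rep a (gwa_coset a (const c)) * rep a (f g)" if "g \<in> G" for g
      using that funs [OF f] c by (auto simp: skew_group_algebra_def sm rep_simps Pi_iff)
    then show "aus (\<lambda>g. rep a ((c \<odot>\<^bsub>?S\<^esub> f) g)) (rep a b) = rep a ((c \<odot>\<^bsub>?E\<^esub> auslander_map R G f) b)"
      using b funs [OF f] c
      by (simp add: right_End_def sm rep_simps auslander_closed rep_auslander aus_def G_simps(1)
          sum_distrib_left mult.assoc)
  qed (auto simp: right_End_def)
  have "inj_on (auslander_map R G) (carrier ?S)"
  proof (rule inj_onI)
    fix f f' assume f: "f \<in> carrier ?S" and f': "f' \<in> carrier ?S"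
      and eq: "auslander_map R G f = auslander_map R G f'"
    show "f = f'"
    proof (rule PiE_ext [OF f [unfolded carr] f' [unfolded carr]])
      fix g assume g: "g \<in> G"
      have "aus (\<lambda>g. rep a (f g)) s = aus (\<lambda>g. rep a (f' g)) s" if "s \<in> gwa_sub a" for s
        using eq rep_auslander [OF funs [OF f]] rep_auslander [OF funs [OF f']] rep_exists [OF that] by metis
      then have "rep a (f g) = rep a (f' g)"
        using aus_inj_on [of "\<lambda>g. rep a (f g)" "\<lambda>g. rep a (f' g)" g] f f' g
        by (simp add: G_simps(1) rep_f)
      then show "f g = f' g" using rep_eq_iff [OF a_nonzero] funs [OF f] funs [OF f'] g by (auto simp: Pi_iff)
    qed
  qed
  moreover have "\<exists>f\<in>carrier ?S. auslander_map R G f = \<phi>" if \<phi>: "\<phi> \<in> carrier ?E" for \<phi>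
  proof -
    have \<phi>_closed: "\<phi> b \<in> carrier R" if "b \<in> carrier R" for b
      using \<phi> that by (auto simp: right_End_def)
    have \<phi>_add: "\<phi> (b \<oplus>\<^bsub>R\<^esub> c) = \<phi> b \<oplus>\<^bsub>R\<^esub> \<phi> c" if "b \<in> carrier R" "c \<in> carrier R" for b c
      using \<phi> that by (auto simp: right_End_def)
    have \<phi>_mult: "\<phi> (b \<otimes>\<^bsub>R\<^esub> s) = \<phi> b \<otimes>\<^bsub>R\<^esub> s" if "b \<in> carrier R" "s \<in> fixed_ring R G" for b s
      using \<phi> that by (auto simp: right_End_def)
    define \<psi> where "\<psi> s = rep a (\<phi> (unrep a s))" for s
    have \<psi>_rep: "\<psi> (rep a b) = rep a (\<phi> b)" if "b \<in> carrier R" for b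
      using that by (simp add: \<psi>_def rep_simps)
    obtain \<rho> where \<rho>: "\<And>g. g \<in> carrier (Aut_fl a\<lparr>carrier := G\<rparr>) \<Longrightarrow> \<rho> g \<in> gwa_sub a"
      and \<psi>_eq: "\<And>b. b \<in> gwa_sub a \<Longrightarrow> \<psi> b = aus \<rho> b"
    proof (rule aus_surjective [of \<psi>])
      show "\<psi> b \<in> gwa_sub a" if "b \<in> gwa_sub a" for b
        by (simp add: \<psi>_def rep_simps \<phi>_closed)
      show "\<psi> (b + c) = \<psi> b + \<psi> c" if bc: "b \<in> gwa_sub a" "c \<in> gwa_sub a" for b c
      proof -
        obtain r s where "r \<in> carrier R" "s \<in> carrier R" "b = rep a r" "c = rep a s"
          using rep_exists bc by blast
        then show ?thesis
          by (simp add: \<psi>_rep rep_add [OF a_nonzero, symmetric] \<phi>_add \<phi>_closed)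
      qed
      show "\<psi> (b * s) = \<psi> b * s" if b: "b \<in> gwa_sub a" and s: "s \<in> fixed" for b s
      proof -
        obtain r where r: "r \<in> carrier R" "b = rep a r" using rep_exists b by blast
        obtain t where t: "t \<in> carrier R" "s = rep a t" using rep_exists s by (auto simp: fixed_def)
        have "t \<in> fixed_ring R G" using s t by (simp add: fixed_ring_iff)
        then show ?thesis
          using r t by (simp add: \<psi>_rep rep_mult [OF a_nonzero, symmetric] \<phi>_mult \<phi>_closed)
      qed
      fix \<rho>
      assume *: "\<And>g. g \<in> carrier (Aut_fl a\<lparr>carrier := G\<rparr>) \<Longrightarrow> \<rho> g \<in> gwa_sub a"
        "\<And>b. b \<in> gwa_sub a \<Longrightarrow> \<psi> b = aus \<rho> b"
      show thesis by (rule that [OF *])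
    qed (rule hom_from_ideal_extends [OF _ a_nonzero])
    define f where "f = (\<lambda>g\<in>G. unrep a (\<rho> g))"
    have f: "f \<in> carrier ?S" by (simp add: f_def carr rep_simps)
    have "auslander_map R G f = \<phi>"
    proof (rule auslander_eqI [OF funs [OF f]])
      show "\<phi> \<in> extensional (carrier R)" using \<phi> by (auto simp: right_End_def PiE_def)
      fix b assume b: "b \<in> carrier R"
      have "aus (\<lambda>g. rep a (f g)) (rep a b) = aus \<rho> (rep a b)"
        unfolding aus_def G_simps(1) using \<rho> by (intro sum.cong) (auto simp: f_def rep_simps G_simps(1))
      then show "aus (\<lambda>g. rep a (f g)) (rep a b) = rep a (\<phi> b)"
        using b \<psi>_eq [of "rep a b"] by (simp add: \<psi>_rep rep_simps)
    qed (rule \<phi>_closed)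
    then show ?thesis using f by blast
  qed
  moreover have "auslander_map R G ` carrier ?S \<subseteq> carrier ?E"
    using hom by (auto simp: ring_hom_def)
  ultimately have "bij_betw (auslander_map R G) (carrier ?S) (carrier ?E)"
    by (auto simp: bij_betw_def image_iff)
  then show ?thesis using hom smult by (simp add: alg_iso_def ring_iso_def)
qed

end

theorem theorem4p4:
  fixes a :: "'k::{alg_closed_field, field_char_0} poly"
    and G :: "('k free_alg set \<Rightarrow> 'k free_alg set) set"
  assumes "lead_coeff a = 1"
    and "poly a 0 = 0"
    and "subgroup G (Aut_fl a)"
    and "finite G"
    and "cyclic_group ((Aut_fl a)\<lparr>carrier := G\<rparr>)"
    and "G \<noteq> {\<one>\<^bsub>Aut_fl a\<^esub>}"
  shows "auslander_map (classical_gwa a) G \<in>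
           alg_iso (skew_group_algebra (classical_gwa a) G)
                   (right_End (fixed_ring (classical_gwa a) G) (classical_gwa a))"
proof -
  have "a \<noteq> 0" using assms(1) by auto
  then have "gwa_action a G" using assms(3,4) by (rule gwa_action.intro)
  then show ?thesis by (rule gwa_action.auslander_map_iso)
qed

end
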